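(* Let $\mathcal{H}_1,\mathcal{H}_2$ be complex Hilbert spaces. (a) Let $\varphi\in\mathcal{M}(\mathcal{P}_1,\mathcal{P}_2)$ and $$\mathcal{U}=\{T\in\mathcal{B}(\mathcal{H}_1,\mathcal{H}_2): TL=\varphi(L)T \text{ for each } L\in\mathcal{S}_{1\varphi}\}.$$ Then $\mathcal{U}=\operatorname{Op}\varphi\cap\operatorname{Op}\varphi^{\perp}$, and $\mathcal{U}$ is a normalizing space. (b) Let $\mathcal{U}\subseteq\mathcal{B}(\mathcal{H}_1,\mathcal{H}_2)$ be a normalizing subspace. Then (i) $\operatorname{Map}\mathcal{U}$ is an ortho-map, and (ii) $\operatorname{Ref}(\mathcal{U})$ equals the closure of $\mathcal{U}$ in the weak operator topology, and equals the closure of $\mathcal{U}$ in the ultraweak (weak* ) topology. (c) Let $\chi\in\mathcal{M}(\mathcal{P}_1,\mathcal{P}_2)$ be an ortho-map. Then $$\operatorname{Op}\chi=\{T\in\mathcal{B}(\mathcal{H}_1,\mathcal{H}_2): TL=\chi(L)T \text{ for each } L\in\mathcal{S}_{1\chi}\}.$$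
   Context: $\mathcal{P}_i$ is the lattice of all orthogonal projections on $\mathcal{H}_i$; $P^\perp=I-P$; projections are identified with their ranges. "Subspace" or "space" of operators means linear subspace. $\mathcal{M}(\mathcal{P}_1,\mathcal{P}_2)$ is the set of maps $\varphi:\mathcal{P}_1\to\mathcal{P}_2$ with $\varphi(0)=0$ that preserve arbitrary suprema. For such $\varphi$, $\mathcal{S}_{2\varphi}=\varphi(\mathcal{P}_1)$ and $\mathcal{S}_{1\varphi}=\{\bigvee\{P\in\mathcal{P}_1:\varphi(P)\le Q\}: Q\in\mathcal{P}_2\}$ (Erdos' semi-lattices; $\varphi$ restricts to a bijection of $\mathcal{S}_{1\varphi}$ onto $\mathcal{S}_{2\varphi}$ and is determined by its restriction to $\mathcal{S}_{1\varphi}$). $\operatorname{Op}\varphi=\{T\in\mathcal{B}(\mathcal{H}_1,\mathcal{H}_2):\varphi(P)^\perp TP=0 \text{ for each }P\in\mathcal{P}_1\}$. For a subspace $\mathcal{U}\subseteq\mathcal{B}(\mathcal{H}_1,\mathcal{H}_2)$, $\operatorname{Map}\mathcal{U}\in\mathcal{M}(\mathcal{P}_1,\mathcal{P}_2)$ sends $P$ to the projection onto the closed linear span of $\{Sx:S\in\mathcal{U},x\in P(\mathcal{H}_1)\}$. $\operatorname{Ref}\mathcal{U}=\{T:Tx\in\overline{\mathcal{U}x}\text{ for each }x\in\mathcal{H}_1\}$. For $\varphi\in\mathcal{M}(\mathcal{P}_1,\mathcal{P}_2)$, $\varphi^\perp$ denotes the map $\operatorname{Map}\mathcal{V}$ of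 the reflexive subspace $\mathcal{V}=\{T:\varphi(L)TL^\perp=0\text{ for each }L\in\mathcal{S}_{1\varphi}\}$ (so $\operatorname{Op}\varphi^\perp=\mathcal{V}$). A subspace $\mathcal{U}$ is normalizing if $AB^*C\in\mathcal{U}$ for all $A,B,C\in\mathcal{U}$. A map $\chi\in\mathcal{M}(\mathcal{P}_1,\mathcal{P}_2)$ is an ortho-map if $\chi(L)\perp\chi(L^\perp)$ for each $L\in\mathcal{S}_{1\chi}$. *)

theory Defs
  imports "HOL-Analysis.Analysis"
begin

text \<open>Complex Hilbert spaces. The inner product is linear in its first argument.\<close>

class complex_inner = real_normed_vector +
  fixes scaleC :: "complex \<Rightarrow> 'a \<Rightarrow> 'a"  (infixr "*\<^sub>C" 75)
    and cinner :: "'a \<Rightarrow> 'a \<Rightarrow> complex"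
  assumes scaleC_add_right: "c *\<^sub>C (x + y) = c *\<^sub>C x + c *\<^sub>C y"
    and scaleC_add_left: "(c + d) *\<^sub>C x = c *\<^sub>C x + d *\<^sub>C x"
    and scaleC_scaleC: "c *\<^sub>C d *\<^sub>C x = (c * d) *\<^sub>C x"
    and scaleC_one: "1 *\<^sub>C x = x"
    and scaleR_scaleC: "r *\<^sub>R x = complex_of_real r *\<^sub>C x"
    and cinner_commute: "cinner x y = cnj (cinner y x)"
    and cinner_add_left: "cinner (x + y) z = cinner x z + cinner y z"
    and cinner_scaleC_left: "cinner (c *\<^sub>C x) y = c * cinner x y"
    and cinner_self_nonneg: "0 \<le> Re (cinner x x)"
    and cinner_self_eq_0_iff: "cinner x x = 0 \<longleftrightarrow> x = 0"
    and norm_eq_sqrt_cinner: "norm x = sqrt (Re (cinner x x))"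

class chilbert_space = complex_inner + complete_space

global_interpretation complex_vector: vector_space "scaleC :: complex \<Rightarrow> 'a \<Rightarrow> 'a::complex_inner"
  by unfold_locales (simp_all add: scaleC_add_right scaleC_add_left scaleC_scaleC scaleC_one)

instantiation complex :: chilbert_space
begin

definition scaleC_complex :: "complex \<Rightarrow> complex \<Rightarrow> complex"
  where "scaleC_complex c x = c * x"

definition cinner_complex :: "complex \<Rightarrow> complex \<Rightarrow> complex"
  where "cinner_complex x y = x * cnj y"

instance
  by standard
    (auto simp: scaleC_complex_def cinner_complex_def algebra_simps scaleR_conv_of_real
      cmod_def power2_eq_square)

end

text \<open>
  Operators are plain functions; \<open>bounded_ops\<close> is the space of bounded complex-linear ones.
\<close>

definition bounded_ops :: "('a::complex_inner \<Rightarrow> 'b::complex_inner) set"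
  where "bounded_ops = {T. bounded_linear T \<and> (\<forall>c x. T (c *\<^sub>C x) = c *\<^sub>C T x)}"

definition operator_space :: "('a::complex_inner \<Rightarrow> 'b::complex_inner) set \<Rightarrow> bool"
  where "operator_space \<U> \<longleftrightarrow>
    \<U> \<subseteq> bounded_ops \<and> (\<lambda>_. 0) \<in> \<U> \<and>
    (\<forall>S\<in>\<U>. \<forall>T\<in>\<U>. (\<lambda>x. S x + T x) \<in> \<U>) \<and>
    (\<forall>c. \<forall>T\<in>\<U>. (\<lambda>x. c *\<^sub>C T x) \<in> \<U>)"

text \<open>On Hilbert spaces, the choice below is unique for every bounded operator.\<close>

definition cadjoint :: "('a::complex_inner \<Rightarrow> 'b::complex_inner) \<Rightarrow> ('b \<Rightarrow> 'a)"
  where "cadjoint T = (SOME S. \<forall>x y. cinner (T x) y = cinner x (S y))"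

definition normalizing :: "('a::complex_inner \<Rightarrow> 'b::complex_inner) set \<Rightarrow> bool"
  where "normalizing \<U> \<longleftrightarrow>
    operator_space \<U> \<and> (\<forall>A\<in>\<U>. \<forall>B\<in>\<U>. \<forall>C\<in>\<U>. A \<circ> cadjoint B \<circ> C \<in> \<U>)"

definition projections :: "('a::complex_inner \<Rightarrow> 'a) set"
  where "projections =
    {P \<in> bounded_ops. P \<circ> P = P \<and> (\<forall>x y. cinner (P x) y = cinner x (P y))}"

definition proj_le :: "('a::complex_inner \<Rightarrow> 'a) \<Rightarrow> ('a \<Rightarrow> 'a) \<Rightarrow> bool"  (infix "\<le>\<^sub>p" 50)
  where "P \<le>\<^sub>p Q \<longleftrightarrow> range P \<subseteq> range Q"

definition proj_perp :: "('a::complex_inner \<Rightarrow> 'a) \<Rightarrow> ('a \<Rightarrow> 'a)"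
  where "proj_perp P = (\<lambda>x. x - P x)"

definition proj_orthogonal :: "('a::complex_inner \<Rightarrow> 'a) \<Rightarrow> ('a \<Rightarrow> 'a) \<Rightarrow> bool"
  where "proj_orthogonal P Q \<longleftrightarrow> (\<forall>x\<in>range P. \<forall>y\<in>range Q. cinner x y = 0)"

definition proj_onto :: "'a::complex_inner set \<Rightarrow> ('a \<Rightarrow> 'a)"
  where "proj_onto M = (THE P. P \<in> projections \<and> range P = M)"

text \<open>The supremum in the lattice of projections; for the empty family it is \<open>0\<close>.\<close>

definition proj_Sup :: "('a::complex_inner \<Rightarrow> 'a) set \<Rightarrow> ('a \<Rightarrow> 'a)"
  where "proj_Sup \<A> = (THE R. R \<in> projections \<and> (\<forall>P\<in>\<A>. P \<le>\<^sub>p R) \<and>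
    (\<forall>Q\<in>projections. (\<forall>P\<in>\<A>. P \<le>\<^sub>p Q) \<longrightarrow> R \<le>\<^sub>p Q))"

text \<open>
  The set \<open>\<M>(\<P>\<^sub>1, \<P>\<^sub>2)\<close>. Values of \<open>\<phi>\<close> outside the set of projections are irrelevant.
\<close>

definition sup_maps :: "(('a::complex_inner \<Rightarrow> 'a) \<Rightarrow> ('b::complex_inner \<Rightarrow> 'b)) set"
  where "sup_maps = {\<phi> \<in> projections \<rightarrow> projections.
    \<phi> (\<lambda>_. 0) = (\<lambda>_. 0) \<and> (\<forall>\<A>\<subseteq>projections. \<phi> (proj_Sup \<A>) = proj_Sup (\<phi> ` \<A>))}"

text \<open>Erdos' semi-lattice \<open>\<S>\<^bsub>1\<phi>\<^esub>\<close>.\<close>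

definition semilattice1 ::
    "(('a::complex_inner \<Rightarrow> 'a) \<Rightarrow> ('b::complex_inner \<Rightarrow> 'b)) \<Rightarrow> ('a \<Rightarrow> 'a) set"
  where "semilattice1 \<phi> = {proj_Sup {P \<in> projections. \<phi> P \<le>\<^sub>p Q} | Q. Q \<in> projections}"

definition Op :: "(('a::complex_inner \<Rightarrow> 'a) \<Rightarrow> ('b::complex_inner \<Rightarrow> 'b)) \<Rightarrow> ('a \<Rightarrow> 'b) set"
  where "Op \<phi> =
    {T \<in> bounded_ops. \<forall>P\<in>projections. proj_perp (\<phi> P) \<circ> T \<circ> P = (\<lambda>_. 0)}"

definition Map ::
    "('a::complex_inner \<Rightarrow> 'b::complex_inner) set \<Rightarrow> ('a \<Rightarrow> 'a) \<Rightarrow> ('b \<Rightarrow> 'b)"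
  where "Map \<U> P =
    proj_onto (closure (complex_vector.span {S x | S x. S \<in> \<U> \<and> x \<in> range P}))"

definition Ref :: "('a::complex_inner \<Rightarrow> 'b::complex_inner) set \<Rightarrow> ('a \<Rightarrow> 'b) set"
  where "Ref \<U> = {T \<in> bounded_ops. \<forall>x. T x \<in> closure {S x | S. S \<in> \<U>}}"

definition map_perp ::
    "(('a::complex_inner \<Rightarrow> 'a) \<Rightarrow> ('b::complex_inner \<Rightarrow> 'b)) \<Rightarrow> (('a \<Rightarrow> 'a) \<Rightarrow> ('b \<Rightarrow> 'b))"
  where "map_perp \<phi> =
    Map {T \<in> bounded_ops. \<forall>L\<in>semilattice1 \<phi>. \<phi> L \<circ> T \<circ> proj_perp L = (\<lambda>_. 0)}"

definition ortho_map :: "(('a::complex_inner \<Rightarrow> 'a) \<Rightarrow> ('b::complex_inner \<Rightarrow> 'b)) \<Rightarrow> bool"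
  where "ortho_map \<psi> \<longleftrightarrow> \<psi> \<in> sup_maps \<and>
    (\<forall>L\<in>semilattice1 \<psi>. proj_orthogonal (\<psi> L) (\<psi> (proj_perp L)))"

definition intertwiners ::
    "(('a::complex_inner \<Rightarrow> 'a) \<Rightarrow> ('b::complex_inner \<Rightarrow> 'b)) \<Rightarrow> ('a \<Rightarrow> 'b) set"
  where "intertwiners \<phi> = {T \<in> bounded_ops. \<forall>L\<in>semilattice1 \<phi>. T \<circ> L = \<phi> L \<circ> T}"

text \<open>
  Both topologies have \<open>bounded_ops\<close> as underlying space. They are the coarsest ones making
  continuous the functionals \<open>T \<mapsto> \<langle>T x, y\<rangle>\<close>, respectively
  \<open>T \<mapsto> \<Sum>n. \<langle>T x\<^sub>n, y\<^sub>n\<rangle>\<close> with \<open>x\<close> and \<open>y\<close> square-summable; the latter functionals are those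
  given by trace-class operators, so that the topology is the weak* topology.
\<close>

definition weak_operator_topology :: "('a::complex_inner \<Rightarrow> 'b::complex_inner) topology"
  where "weak_operator_topology = topology_generated_by
    {{T \<in> bounded_ops. cinner (T x) y \<in> V} | x y V. open V}"

definition ultraweak_topology :: "('a::complex_inner \<Rightarrow> 'b::complex_inner) topology"
  where "ultraweak_topology = topology_generated_by
    {{T \<in> bounded_ops. (\<Sum>n. cinner (T (x n)) (y n)) \<in> V} | x y V.
      summable (\<lambda>n. (norm (x n))\<^sup>2) \<and> summable (\<lambda>n. (norm (y n))\<^sup>2) \<and> open V}"

end

theory Submission
  imports Defs
begin

text \<open>
  Parts (a) and (c) are algebra with projections. The relation \<open>T L = \<phi>(L) T\<close> says that \<open>T\<close> maps
  \<open>L\<close> into \<open>\<phi>(L)\<close> and that \<open>\<phi>(L) T L\<^sup>\<bottom> = 0\<close>. The second condition defines \<open>Op \<phi>\<^sup>\<bottom>\<close>. The first one is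
  that of \<open>Op \<phi>\<close>, except that \<open>L\<close> is restricted to the semi-lattice, and this makes no difference
  because each \<open>P\<close> lies below some \<open>L\<close> with \<open>\<phi>(L) = \<phi>(P)\<close> (lemmas \<open>semilattice1_cofinal\<close> and
  \<open>intertwiners_eq_Op_Int\<close>). For an ortho-map the first condition, applied to \<open>L\<^sup>\<bottom>\<close>, implies the
  second one. If \<open>\<U>\<close> is normalizing, each \<open>L\<close> in the semi-lattice of \<open>Map \<U>\<close> is invariant under
  \<open>T\<^sup>* S\<close> for \<open>S, T \<in> \<U>\<close>, so \<open>S L \<bottom> T L\<^sup>\<bottom>\<close> and \<open>Map \<U>\<close> is an ortho-map (\<open>ortho_map_Map\<close>).

  Both closures of \<open>\<U>\<close> are contained in \<open>Ref \<U>\<close>, since a closed subspace is cut out by the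
  functionals \<open>\<langle>\<cdot>, y\<rangle>\<close>. The substance is the density of \<open>\<U>\<close> in \<open>Ref \<U>\<close>, which is proved like the
  double commutant theorem. An ultraweak neighbourhood of \<open>T\<close> is controlled by one square-summable
  sequence \<open>x\<close>, that is, by one vector for the amplification \<open>T\<^sup>\<infinity>\<close>, which acts on \<open>\<ell>\<^sup>2\<close> in each
  coordinate (\<open>ultraweak_neighbourhood\<close>). So it is enough that \<open>T\<^sup>\<infinity> x\<close> lies in the closure \<open>K\<close> of
  \<open>\<U>\<^sup>\<infinity> x\<close> (\<open>amplify_Ref\<close>). The normalizing property provides projections \<open>P\<close> and \<open>Q\<close>, the latter
  onto \<open>K\<close>, with \<open>P x = x\<close> and \<open>S\<^sup>\<infinity> P = Q S\<^sup>\<infinity>\<close> for all \<open>S \<in> \<U>\<close>; in terms of matrix entries,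
  \<open>S p\<^sub>m\<^sub>n = q\<^sub>m\<^sub>n S\<close>. If \<open>T\<close> satisfies the same relations, then \<open>T\<^sup>\<infinity> x = Q T\<^sup>\<infinity> x \<in> K\<close>.

  It remains to pass from \<open>S X = Y S\<close> for all \<open>S \<in> \<U>\<close> to \<open>T X = Y T\<close>, where \<open>X\<close> and \<open>Y\<close> may be taken to
  be self-adjoint and even positive (\<open>Ref_intertwines\<close>). Elements of \<open>\<U>\<close> map the spectral
  subspaces of \<open>X\<close> into those of \<open>Y\<close>, and likewise their orthogonal complements. Statements of
  this form pass from \<open>\<U>\<close> to \<open>T\<close> vector by vector, and \<open>T X = Y T\<close> follows by cutting the spectrum
  into short intervals (\<open>intertwine_of_spectral_below\<close>). Spectral subspaces are available without
  a functional calculus: that of \<open>A \<ge> 0\<close> for the interval \<open>[0, c]\<close> consists of the vectors \<open>u\<close> for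
  which \<open>\<parallel>A\<^sup>n u\<parallel>\<close> grows at most like \<open>c\<^sup>n\<close>. The main point about it is that \<open>A \<ge> c\<close> on its
  orthogonal complement (\<open>bounded_orbit_lower\<close>).
\<close>


section \<open>Geometry of complex Hilbert spaces\<close>

lemma cinner_add_right: "cinner x (y + z) = cinner x y + cinner x (z :: 'a::complex_inner)"
  by (metis cinner_add_left cinner_commute complex_cnj_add)

lemma cinner_scaleC_right: "cinner x (c *\<^sub>C y) = cnj c * cinner x (y :: 'a::complex_inner)"
  by (metis cinner_commute cinner_scaleC_left complex_cnj_mult)

lemma cinner_flip: "cinner x y = cinner z w \<Longrightarrow> cinner y x = cinner w z"
  unfolding cinner_commute[of y x] cinner_commute[of w z] by (rule arg_cong)

lemma cinner_zero_left [simp]: "cinner 0 (y :: 'a::complex_inner) = 0"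
  using cinner_add_left[of 0 0 y] by simp

lemma cinner_zero_right [simp]: "cinner (y :: 'a::complex_inner) 0 = 0"
  using cinner_add_right[of y 0 0] by simp

lemma cinner_minus_left: "cinner (- x) (y :: 'a::complex_inner) = - cinner x y"
  using cinner_add_left[of x "- x" y] by (simp add: eq_neg_iff_add_eq_0 add.commute)

lemma cinner_minus_right: "cinner x (- y :: 'a::complex_inner) = - cinner x y"
  using cinner_add_right[of x y "- y"] by (simp add: eq_neg_iff_add_eq_0 add.commute)

lemma cinner_diff_left: "cinner (x - y) (z :: 'a::complex_inner) = cinner x z - cinner y z"
  using cinner_add_left[of x "- y" z] by (simp add: cinner_minus_left)

lemma cinner_diff_right: "cinner x (y - z :: 'a::complex_inner) = cinner x y - cinner x z"
  using cinner_add_right[of x y "- z"] by (simp add: cinner_minus_right)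

lemma cinner_scaleR_left: "cinner (r *\<^sub>R x) (y :: 'a::complex_inner) = r *\<^sub>R cinner x y"
  by (simp add: scaleR_scaleC[where 'a='a] cinner_scaleC_left scaleR_conv_of_real)

lemma cinner_scaleR_right: "cinner x (r *\<^sub>R y :: 'a::complex_inner) = r *\<^sub>R cinner x y"
  by (simp add: scaleR_scaleC[where 'a='a] cinner_scaleC_right scaleR_conv_of_real)

lemma cinner_sum_left: "cinner (sum f A) (y :: 'a::complex_inner) = (\<Sum>i\<in>A. cinner (f i) y)"
  by (induction A rule: infinite_finite_induct) (auto simp: cinner_add_left)

lemma cinner_sum_right: "cinner y (sum f A :: 'a::complex_inner) = (\<Sum>i\<in>A. cinner y (f i))"
  by (induction A rule: infinite_finite_induct) (auto simp: cinner_add_right)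

lemmas cinner_linear_simps =
  cinner_add_left cinner_add_right cinner_diff_left cinner_diff_right cinner_minus_left
  cinner_minus_right cinner_scaleC_left cinner_scaleC_right cinner_scaleR_left cinner_scaleR_right

lemma cinner_self: "cinner x x = complex_of_real ((norm (x :: 'a::complex_inner))\<^sup>2)"
proof -
  have "Im (cinner x x) = 0"
    using arg_cong[OF cinner_commute[of x x], of Im] by simp
  moreover have "Re (cinner x x) = (norm x)\<^sup>2"
    using cinner_self_nonneg[of x] by (simp add: norm_eq_sqrt_cinner)
  ultimately show ?thesis
    by (simp add: complex_eq_iff)
qed

lemma norm_sq_cinner: "(norm (x :: 'a::complex_inner))\<^sup>2 = Re (cinner x x)"
  by (simp add: cinner_self)

lemma norm_scaleC: "norm (c *\<^sub>C (x :: 'a::complex_inner)) = cmod c * norm x"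
proof -
  have "cinner (c *\<^sub>C x) (c *\<^sub>C x) = (c * cnj c) * cinner x x"
    by (simp add: cinner_scaleC_left cinner_scaleC_right)
  also have "\<dots> = complex_of_real ((cmod c * norm x)\<^sup>2)"
    by (simp add: cinner_self complex_norm_square[symmetric] power_mult_distrib)
  finally have "(norm (c *\<^sub>C x))\<^sup>2 = (cmod c * norm x)\<^sup>2"
    by (simp only: norm_sq_cinner Re_complex_of_real)
  then show ?thesis
    by (simp add: power2_eq_iff_nonneg)
qed

lemma norm_sq_add: "(norm (x + y :: 'a::complex_inner))\<^sup>2 = (norm x)\<^sup>2 + (norm y)\<^sup>2 + 2 * Re (cinner x y)"
proof -
  have "Re (cinner y x) = Re (cinner x y)"
    using cinner_commute[of y x] by simp
  then show ?thesis
    by (simp add: norm_sq_cinner cinner_linear_simps)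
qed

lemma norm_sq_diff: "(norm (x - y :: 'a::complex_inner))\<^sup>2 = (norm x)\<^sup>2 + (norm y)\<^sup>2 - 2 * Re (cinner x y)"
  using norm_sq_add[of x "- y"] by (simp add: cinner_minus_right)

lemma pythagoras:
  "cinner x y = 0 \<Longrightarrow> (norm (x + y :: 'a::complex_inner))\<^sup>2 = (norm x)\<^sup>2 + (norm y)\<^sup>2"
  by (simp add: norm_sq_add)

lemma parallelogram:
  "(norm (x - y :: 'a::complex_inner))\<^sup>2 = 2 * (norm x)\<^sup>2 + 2 * (norm y)\<^sup>2 - (norm (x + y))\<^sup>2"
  by (simp add: norm_sq_add norm_sq_diff)

text \<open>Some phase \<open>c\<close> turns \<open>z\<close> into its modulus.\<close>

lemma Re_le_imp_cmod_le:
  assumes "\<And>c. cmod c = 1 \<Longrightarrow> Re (c * z) \<le> r"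
  shows "cmod z \<le> r"
proof (cases "z = 0")
  case True
  then show ?thesis using assms[of 1] by simp
next
  case False
  have "cmod (cnj z / cmod z) = 1"
    using False by (simp add: norm_divide)
  moreover have "cnj z / cmod z * z = complex_of_real (cmod z)"
    using False complex_norm_square[of z] by (simp add: field_simps power2_eq_square)
  then have "Re (cnj z / cmod z * z) = cmod z"
    by (metis Re_complex_of_real)
  ultimately show ?thesis using assms by metis
qed

lemma cauchy_schwarz: "cmod (cinner x y) \<le> norm x * norm (y :: 'a::complex_inner)"
proof (rule Re_le_imp_cmod_le)
  fix c :: complex
  assume c: "cmod c = 1"
  have "norm (c *\<^sub>C x + y) \<le> norm x + norm y"
    using norm_triangle_ineq[of "c *\<^sub>C x" y] c by (simp add: norm_scaleC)
  then have "(norm (c *\<^sub>C x + y))\<^sup>2 \<le> (norm x + norm y)\<^sup>2"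
    by (simp add: power_mono)
  then show "Re (c * cinner x y) \<le> norm x * norm y"
    using c by (simp add: norm_sq_add norm_scaleC cinner_scaleC_left power2_sum)
qed

lemma Re_cinner_le: "Re (cinner x y) \<le> norm x * norm (y :: 'a::complex_inner)"
  using cauchy_schwarz complex_Re_le_cmod order_trans by blast

lemma bounded_bilinear_cinner: "bounded_bilinear (cinner :: 'a::complex_inner \<Rightarrow> 'a \<Rightarrow> complex)"
  by standard (auto simp: cinner_linear_simps intro!: exI[of _ 1] cauchy_schwarz)

lemmas continuous_on_cinner [continuous_intros] =
  bounded_bilinear.continuous_on[OF bounded_bilinear_cinner]

lemma bounded_linear_scaleC: "bounded_linear (\<lambda>x :: 'a::complex_inner. c *\<^sub>C x)"
proof (rule bounded_linear_intro)
  show "c *\<^sub>C r *\<^sub>R x = r *\<^sub>R c *\<^sub>C x" for r and x :: 'a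
    by (simp add: scaleR_scaleC scaleC_scaleC mult.commute)
  show "norm (c *\<^sub>C x) \<le> norm x * cmod c" for x :: 'a
    by (simp add: norm_scaleC mult.commute)
qed (rule scaleC_add_right)

lemma cinner_eq_0_ext: "(\<And>y. cinner x y = 0) \<Longrightarrow> x = (0 :: 'a::complex_inner)"
  using cinner_self_eq_0_iff by blast

lemma cinner_ext: "(\<And>y. cinner x y = cinner x' y) \<Longrightarrow> x = (x' :: 'a::complex_inner)"
  using cinner_eq_0_ext[of "x - x'"] by (simp add: cinner_diff_left)


section \<open>Closed subspaces and orthogonal projections\<close>

abbreviation closed_csubspace :: "'a::complex_inner set \<Rightarrow> bool"
  where "closed_csubspace M \<equiv> complex_vector.subspace M \<and> closed M"

definition ortho_compl :: "'a::complex_inner set \<Rightarrow> 'a set"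
  where "ortho_compl M = {x. \<forall>y\<in>M. cinner x y = 0}"

lemma closed_csubspace_ortho_compl: "closed_csubspace (ortho_compl (M :: 'a::complex_inner set))"
proof
  show "complex_vector.subspace (ortho_compl M)"
    by (auto simp: ortho_compl_def complex_vector.subspace_def cinner_linear_simps)
  have "ortho_compl M = (\<Inter>y\<in>M. {x. cinner x y = 0})"
    by (auto simp: ortho_compl_def)
  then show "closed (ortho_compl M)"
    by (auto intro!: closed_INT closed_Collect_eq continuous_intros)
qed

lemma closed_span_subset:
  assumes "A \<subseteq> M" "closed_csubspace (M :: 'a::complex_inner set)"
  shows "closure (complex_vector.span A) \<subseteq> M"
  using assms by (simp add: closure_minimal complex_vector.span_minimal)

lemma subset_closed_span: "A \<subseteq> closure (complex_vector.span (A :: 'a::complex_inner set))"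
  using complex_vector.span_superset closure_subset by blast

lemma closed_csubspace_closure:
  assumes "complex_vector.subspace (M :: 'a::complex_inner set)"
  shows "closed_csubspace (closure M)"
proof
  show "complex_vector.subspace (closure M)"
    unfolding complex_vector.subspace_def
  proof (intro conjI ballI allI)
    show "0 \<in> closure M"
      using assms closure_subset complex_vector.subspace_0 by blast
    fix x y assume "x \<in> closure M" "y \<in> closure M"
    then obtain f g where "\<forall>n. f n \<in> M" "f \<longlonglongrightarrow> x" "\<forall>n. g n \<in> M" "g \<longlonglongrightarrow> y"
      unfolding closure_sequential by auto
    then have "\<forall>n. f n + g n \<in> M" "(\<lambda>n. f n + g n) \<longlonglongrightarrow> x + y"
      using assms by (auto simp: complex_vector.subspace_def intro: tendsto_add)
    then show "x + y \<in> closure M"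
      unfolding closure_sequential by (intro exI[of _ "\<lambda>n. f n + g n"] conjI)
  next
    fix x c assume "x \<in> closure M"
    then obtain f where "\<forall>n. f n \<in> M" "f \<longlonglongrightarrow> x"
      unfolding closure_sequential by auto
    then have "\<forall>n. c *\<^sub>C f n \<in> M" "(\<lambda>n. c *\<^sub>C f n) \<longlonglongrightarrow> c *\<^sub>C x"
      using assms by (auto simp: complex_vector.subspace_def
          intro: bounded_linear.tendsto[OF bounded_linear_scaleC])
    then show "c *\<^sub>C x \<in> closure M"
      unfolding closure_sequential by (intro exI[of _ "\<lambda>n. c *\<^sub>C f n"] conjI)
  qed
qed simp

lemma closed_csubspace_closed_span:
  "closed_csubspace (closure (complex_vector.span (A :: 'a::complex_inner set)))"
  by (intro closed_csubspace_closure complex_vector.subspace_span)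

text \<open>
  Bounded closed convex sets in a Hilbert space have the finite intersection property along
  sequences: vectors of almost minimal norm form a Cauchy sequence by the parallelogram law.
  This gives nearest points in closed subspaces, and it replaces weak compactness further on.
\<close>

lemma nested_convex_Inter_nonempty:
  fixes C :: "nat \<Rightarrow> 'a::chilbert_space set"
  assumes ne: "\<And>n. C n \<noteq> {}" and cl: "\<And>n. closed (C n)" and dec: "decseq C"
    and mid: "\<And>n x y. x \<in> C n \<Longrightarrow> y \<in> C n \<Longrightarrow> (1/2) *\<^sub>R (x + y) \<in> C n"
    and bdd: "\<And>n. \<exists>x\<in>C n. norm x \<le> B"
  shows "\<exists>x. \<forall>n. x \<in> C n"
proof -
  define e where "e n = 1 / real (Suc n)" for n
  have e: "e n > 0" "e m \<le> e n" if "n \<le> m" for m n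
    using that by (auto simp: e_def frac_le)
  define d where "d n = (INF x\<in>C n. (norm x)\<^sup>2)" for n
  have bb: "bdd_below ((\<lambda>x. (norm x)\<^sup>2) ` C n)" for n
    by (intro bdd_belowI[of _ 0]) auto
  have d_le: "d n \<le> (norm x)\<^sup>2" if "x \<in> C n" for n x
    unfolding d_def using bb that by (rule cINF_lower)
  have sub: "C m \<subseteq> C n" if "n \<le> m" for m n
    using dec that by (simp add: decseq_def)
  have "incseq d"
    unfolding incseq_def d_def using sub bb ne by (intro allI impI cINF_superset_mono) auto
  moreover have "d n \<le> B\<^sup>2" for n
  proof -
    obtain x where "x \<in> C n" "norm x \<le> B"
      using bdd by blast
    then show ?thesis
      using d_le[of x n] power_mono[of "norm x" B 2] by simp
  qed
  ultimately obtain l where l: "d \<longlonglongrightarrow> l" "\<And>n. d n \<le> l"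
    using incseq_convergent by blast
  have "\<exists>x\<in>C n. (norm x)\<^sup>2 < d n + e n" for n
    using cINF_less_iff[OF ne bb, of n "d n + e n"] e(1)[of n n] by (simp add: d_def)
  then obtain f where f: "\<And>n. f n \<in> C n" "\<And>n. (norm (f n))\<^sup>2 < d n + e n"
    by metis
  have dist_le: "(norm (f m - f n))\<^sup>2 \<le> 4 * (l - d n) + 4 * e n" if "n \<le> m" for m n
  proof -
    have "d n \<le> (norm ((1/2) *\<^sub>R (f m + f n)))\<^sup>2"
      using f sub[OF that] by (intro d_le mid) auto
    then have "4 * d n \<le> (norm (f m + f n))\<^sup>2"
      by (simp add: power_divide)
    then show ?thesis
      using parallelogram[of "f m" "f n"] f(2)[of m] f(2)[of n] l(2)[of m] l(2)[of n] e(2)[OF that]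
      by (smt (verit, best))
  qed
  have lim0: "(\<lambda>n. 4 * (l - d n) + 4 * e n) \<longlonglongrightarrow> 4 * (l - l) + 4 * 0"
    unfolding e_def by (intro tendsto_intros l LIMSEQ_Suc lim_const_over_n)
  have "Cauchy f"
  proof (rule CauchyI)
    fix r :: real assume r: "r > 0"
    then have "0 < (r/2)\<^sup>2" by simp
    then have "\<forall>\<^sub>F n in sequentially. 4 * (l - d n) + 4 * e n < (r/2)\<^sup>2"
      using lim0 by (intro order_tendstoD(2)[OF lim0]) simp
    then obtain N where "4 * (l - d N) + 4 * e N < (r/2)\<^sup>2"
      by (auto simp: eventually_sequentially)
    then have half: "norm (f m - f N) < r/2" if "N \<le> m" for m
      using dist_le[OF that] r power2_less_imp_less[of "norm (f m - f N)" "r/2"] by simp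
    have "norm (f m - f n) < r" if "N \<le> m" "N \<le> n" for m n
      using half[OF that(1)] half[OF that(2)] dist_triangle2[of "f m" "f n" "f N"]
      by (simp add: dist_norm)
    then show "\<exists>M. \<forall>m\<ge>M. \<forall>n\<ge>M. norm (f m - f n) < r" by blast
  qed
  then obtain x where x: "f \<longlonglongrightarrow> x"
    using Cauchy_convergent_iff convergent_def by blast
  have "x \<in> C n" for n
  proof (rule Lim_in_closed_set[OF cl _ _ x])
    show "\<forall>\<^sub>F m in sequentially. f m \<in> C n"
      unfolding eventually_sequentially using f(1) sub by blast
  qed simp
  then show ?thesis by blast
qed

text \<open>
  The points of \<open>M\<close> whose distance from \<open>x\<close> exceeds the minimum by little form a nested sequence
  of convex sets. A common point is nearest to \<open>x\<close>.
\<close>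

lemma closed_subspace_decomposition:
  fixes M :: "'a::chilbert_space set"
  assumes M: "closed_csubspace M"
  shows "\<exists>m\<in>M. x - m \<in> ortho_compl M"
proof -
  define d where "d = (INF m\<in>M. (norm (x - m))\<^sup>2)"
  have ne: "M \<noteq> {}"
    using M complex_vector.subspace_0 by blast
  have bb: "bdd_below ((\<lambda>m. (norm (x - m))\<^sup>2) ` M)"
    by (intro bdd_belowI[of _ 0]) auto
  have d_le: "d \<le> (norm (x - m))\<^sup>2" if "m \<in> M" for m
    unfolding d_def using bb that by (rule cINF_lower)
  have near: "\<exists>m\<in>M. (norm (x - m))\<^sup>2 < d + e" if "e > 0" for e
    using cINF_less_iff[OF ne bb, of "d + e"] that by (simp add: d_def)
  define C where "C n = {m \<in> M. (norm (x - m))\<^sup>2 \<le> d + 1 / real (Suc n)}" for n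
  have Cne: "\<exists>m\<in>C n. norm m \<le> norm x + sqrt (d + 1)" for n
  proof -
    obtain m where m: "m \<in> M" "(norm (x - m))\<^sup>2 < d + 1 / real (Suc n)"
      using near[of "1 / real (Suc n)"] by auto
    moreover have "1 / real (Suc n) \<le> 1" by simp
    ultimately have "norm (x - m) \<le> sqrt (d + 1)"
      by (intro real_le_rsqrt) linarith
    moreover have "norm m \<le> norm x + norm (x - m)"
      by (metis norm_minus_commute norm_triangle_sub)
    ultimately show ?thesis
      using m by (intro bexI[of _ m]) (auto simp: C_def)
  qed
  have "\<exists>m. \<forall>n. m \<in> C n"
  proof (rule nested_convex_Inter_nonempty)
    show "C n \<noteq> {}" for n using Cne by blast
    have "C n = M \<inter> {m. (norm (x - m))\<^sup>2 \<le> d + 1 / real (Suc n)}" for n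
      by (auto simp: C_def)
    then show "closed (C n)" for n
      using M by (auto intro!: closed_Int closed_Collect_le continuous_intros)
    show "decseq C"
      unfolding decseq_def C_def by (auto intro: order_trans simp: frac_le)
    show "\<exists>m\<in>C n. norm m \<le> norm x + sqrt (d + 1)" for n by (rule Cne)
    fix n y z assume y: "y \<in> C n" and z: "z \<in> C n"
    have "(1/2) *\<^sub>R (y + z) \<in> M"
      using y z M by (auto simp: C_def scaleR_scaleC complex_vector.subspace_def)
    moreover have "(norm (x - (1/2) *\<^sub>R (y + z)))\<^sup>2 \<le> d + 1 / real (Suc n)"
    proof -
      have "(x - y) + (x - z) = 2 *\<^sub>R (x - (1/2) *\<^sub>R (y + z))"
        by (simp add: algebra_simps scaleR_2)
      then have "(norm ((x - y) + (x - z)))\<^sup>2 = 4 * (norm (x - (1/2) *\<^sub>R (y + z)))\<^sup>2"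
        by (simp add: power_mult_distrib)
      then show ?thesis
        using parallelogram[of "x - y" "x - z"] y z zero_le_power2[of "norm ((x - y) - (x - z))"]
        unfolding C_def by auto
    qed
    ultimately show "(1/2) *\<^sub>R (y + z) \<in> C n" by (simp add: C_def)
  qed
  then obtain m where m: "\<And>n. m \<in> C n" by blast
  have "m \<in> M" using m by (simp add: C_def)
  have "(norm (x - m))\<^sup>2 \<le> d"
  proof (rule LIMSEQ_le_const)
    show "(\<lambda>n. d + 1 / real (Suc n)) \<longlonglongrightarrow> d"
      using LIMSEQ_Suc[OF lim_const_over_n[of 1]] tendsto_add[of "\<lambda>_. d" d] by fastforce
    show "\<exists>N. \<forall>n\<ge>N. (norm (x - m))\<^sup>2 \<le> d + 1 / real (Suc n)"
      using m by (auto simp: C_def)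
  qed
  \<comment> \<open>Moving from the nearest point towards \<open>y\<close> by \<open>\<langle>x - m, y\<rangle> / \<parallel>y\<parallel>\<^sup>2\<close> would bring it nearer.\<close>
  have "cinner (x - m) y = 0" if y: "y \<in> M" for y
  proof (cases "y = 0")
    case False
    define z where "z = cinner (x - m) y"
    define c where "c = z / complex_of_real ((norm y)\<^sup>2)"
    have "(norm (x - m))\<^sup>2 \<le> (norm ((x - m) - c *\<^sub>C y))\<^sup>2"
    proof -
      have "m + c *\<^sub>C y \<in> M"
        using \<open>m \<in> M\<close> y M by (auto simp: complex_vector.subspace_def)
      from d_le[OF this] \<open>(norm (x - m))\<^sup>2 \<le> d\<close> show ?thesis
        unfolding diff_diff_eq by linarith
    qed
    moreover have "Re (cinner (x - m) (c *\<^sub>C y)) = (cmod z)\<^sup>2 / (norm y)\<^sup>2"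
    proof -
      have "cinner (x - m) (c *\<^sub>C y) = complex_of_real ((cmod z)\<^sup>2 / (norm y)\<^sup>2)"
        unfolding cinner_scaleC_right z_def[symmetric]
        using complex_norm_square[of z] by (simp add: c_def mult.commute)
      then show ?thesis by (metis Re_complex_of_real)
    qed
    moreover have "(norm (c *\<^sub>C y))\<^sup>2 = (cmod z)\<^sup>2 / (norm y)\<^sup>2"
    proof -
      have "cmod c = cmod z / (norm y)\<^sup>2"
        by (simp add: c_def norm_divide norm_power)
      then show ?thesis
        using False by (simp add: norm_scaleC power2_eq_square field_simps)
    qed
    ultimately have "(cmod z)\<^sup>2 / (norm y)\<^sup>2 \<le> 0"
      by (simp add: norm_sq_diff[of "x - m"])
    then show ?thesis
      using False by (simp add: divide_le_0_iff z_def)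
  qed simp
  then show ?thesis
    using \<open>m \<in> M\<close> by (auto simp: ortho_compl_def)
qed

lemma bounded_ops_bounded_linear: "T \<in> bounded_ops \<Longrightarrow> bounded_linear T"
  by (simp add: bounded_ops_def)

lemma bounded_ops_scaleC: "T \<in> bounded_ops \<Longrightarrow> T (c *\<^sub>C x) = c *\<^sub>C T x"
  by (simp add: bounded_ops_def)

lemma bounded_ops_add: "T \<in> bounded_ops \<Longrightarrow> T (x + y) = T x + T y"
  by (simp add: bounded_ops_def linear_simps)

lemma bounded_ops_diff: "T \<in> bounded_ops \<Longrightarrow> T (x - y) = T x - T y"
  by (simp add: bounded_ops_def linear_simps)

lemma bounded_ops_0 [simp]: "T \<in> bounded_ops \<Longrightarrow> T 0 = 0"
  by (simp add: bounded_ops_def linear_simps)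

lemma bounded_ops_scaleR: "T \<in> bounded_ops \<Longrightarrow> T (r *\<^sub>R x) = r *\<^sub>R T x"
  by (simp add: bounded_ops_def linear_simps)

lemmas bounded_ops_simps =
  bounded_ops_scaleC bounded_ops_add bounded_ops_diff bounded_ops_scaleR

lemma bounded_ops_norm_le: "T \<in> bounded_ops \<Longrightarrow> norm (T x) \<le> onorm T * norm x"
  by (simp add: bounded_ops_def onorm)

lemma continuous_on_bounded_ops: "T \<in> bounded_ops \<Longrightarrow> continuous_on A T"
  by (simp add: bounded_ops_def linear_continuous_on)

lemma bounded_opsI:
  assumes "\<And>x y. T (x + y) = T x + T y" "\<And>c x. T (c *\<^sub>C x) = c *\<^sub>C T x"
    and "\<And>x. norm (T x) \<le> norm x * K"
  shows "T \<in> bounded_ops"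
  unfolding bounded_ops_def
  using assms by (auto intro!: bounded_linear_intro[where K = K] simp: scaleR_scaleC)

lemma bounded_ops_comp: "S \<in> bounded_ops \<Longrightarrow> T \<in> bounded_ops \<Longrightarrow> S \<circ> T \<in> bounded_ops"
  by (auto simp: bounded_ops_def comp_def intro: bounded_linear_compose)

lemma bounded_ops_plus:
  "S \<in> bounded_ops \<Longrightarrow> T \<in> bounded_ops \<Longrightarrow> (\<lambda>x. S x + T x) \<in> bounded_ops"
  by (auto simp: bounded_ops_def scaleC_add_right intro: bounded_linear_add)

lemma bounded_ops_minus:
  "S \<in> bounded_ops \<Longrightarrow> T \<in> bounded_ops \<Longrightarrow> (\<lambda>x. S x - T x) \<in> bounded_ops"
  by (auto simp: bounded_ops_def complex_vector.scale_right_diff_distrib intro: bounded_linear_sub)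

lemma bounded_ops_scale: "T \<in> bounded_ops \<Longrightarrow> (\<lambda>x. c *\<^sub>C T x) \<in> bounded_ops"
  unfolding bounded_ops_def
  by (auto simp: scaleC_scaleC mult.commute
      intro: bounded_linear_compose[OF bounded_linear_scaleC, unfolded comp_def])

lemma bounded_ops_id: "(\<lambda>x. x) \<in> bounded_ops"
  by (simp add: bounded_ops_def)

lemma bounded_ops_zero: "(\<lambda>x. 0) \<in> bounded_ops"
  by (simp add: bounded_ops_def)

lemma closed_csubspace_vimage:
  assumes "T \<in> bounded_ops" "closed_csubspace M"
  shows "closed_csubspace {x. T x \<in> M}"
proof
  show "complex_vector.subspace {x. T x \<in> M}"
    using assms by (auto simp: complex_vector.subspace_def bounded_ops_simps)
  show "closed {x. T x \<in> M}"
    using assms continuous_closed_vimage[of M T] continuous_on_bounded_ops[of T UNIV]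
    by (simp add: vimage_def continuous_on_eq_continuous_at)
qed

lemma closed_csubspace_INT:
  assumes "\<And>i. i \<in> I \<Longrightarrow> closed_csubspace (M i)"
  shows "closed_csubspace (\<Inter>i\<in>I. M i)"
  using assms by (auto simp: complex_vector.subspace_def intro!: closed_INT)

lemma projections_bounded_ops: "P \<in> projections \<Longrightarrow> P \<in> bounded_ops"
  by (simp add: projections_def)

lemma projections_idem: "P \<in> projections \<Longrightarrow> P (P x) = P x"
  unfolding projections_def by (auto dest: fun_cong)

lemma projections_cinner: "P \<in> projections \<Longrightarrow> cinner (P x) y = cinner x (P y)"
  by (simp add: projections_def)

lemma range_projection:
  assumes "P \<in> projections" shows "range P = {x. P x = x}"
  using projections_idem[OF assms] by (auto intro: range_eqI[OF sym])

lemma in_range_projection_iff: "P \<in> projections \<Longrightarrow> x \<in> range P \<longleftrightarrow> P x = x"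
  by (simp add: range_projection)

lemma closed_csubspace_range_projection:
  assumes "P \<in> projections" shows "closed_csubspace (range P)"
proof -
  have "range P = {x. (\<lambda>x. P x - x) x \<in> {0}}"
    using assms by (simp add: range_projection)
  moreover have "closed_csubspace {0 :: 'a}" by simp
  ultimately show ?thesis
    using closed_csubspace_vimage[OF bounded_ops_minus[OF projections_bounded_ops[OF assms]
        bounded_ops_id], of "{0}"] by simp
qed

lemma ortho_compl_range_projection:
  assumes "P \<in> projections"
  shows "ortho_compl (range P) = {x. P x = 0}"
proof -
  have "P x = 0 \<longleftrightarrow> (\<forall>y. cinner x (P y) = 0)" for x
    using projections_cinner[OF assms] cinner_eq_0_ext by (metis cinner_zero_left)
  then show ?thesis by (auto simp: ortho_compl_def)
qed

text \<open>
  Equal ranges give \<open>P = Q P\<close> and \<open>Q = P Q\<close>, and these two products are adjoint to each other.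
\<close>

lemma projections_eqI:
  assumes P: "P \<in> projections" and Q: "Q \<in> projections" and eq: "range P = range Q"
  shows "P = Q"
proof
  fix x
  have "Q (P z) = P z" "P (Q z) = Q z" for z
    using eq in_range_projection_iff[OF P] in_range_projection_iff[OF Q] by auto
  then have "cinner (P x) y = cinner (Q x) y" for y
    using projections_cinner[OF P] projections_cinner[OF Q] by metis
  then show "P x = Q x" by (rule cinner_ext)
qed

lemma projection_onto_exists:
  fixes M :: "'a::chilbert_space set"
  assumes M: "closed_csubspace M"
  shows "\<exists>P\<in>projections. range P = M"
proof -
  define P where "P x = (SOME m. m \<in> M \<and> x - m \<in> ortho_compl M)" for x
  have P: "P x \<in> M" "x - P x \<in> ortho_compl M" for x
    using someI_ex[of "\<lambda>m. m \<in> M \<and> x - m \<in> ortho_compl M"] closed_subspace_decomposition[OF M]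
    unfolding P_def by blast+
  have uniq: "m = P x" if "m \<in> M" "x - m \<in> ortho_compl M" for m x
  proof -
    have "m - P x \<in> M"
      using that P M complex_vector.subspace_diff by blast
    moreover have "m - P x = (x - P x) - (x - m)" by simp
    then have "m - P x \<in> ortho_compl M"
      using that P closed_csubspace_ortho_compl complex_vector.subspace_diff by metis
    ultimately have "cinner (m - P x) (m - P x) = 0"
      by (auto simp: ortho_compl_def)
    then show ?thesis by (simp add: cinner_self_eq_0_iff)
  qed
  have sub: "complex_vector.subspace M" "complex_vector.subspace (ortho_compl M)"
    using M closed_csubspace_ortho_compl by auto
  have "P (x + y) = P x + P y" for x y
  proof (rule uniq[symmetric])
    have "x + y - (P x + P y) = (x - P x) + (y - P y)" by simp
    then show "x + y - (P x + P y) \<in> ortho_compl M"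
      using P sub complex_vector.subspace_add by metis
  qed (use P sub complex_vector.subspace_add in blast)
  moreover have "P (c *\<^sub>C x) = c *\<^sub>C P x" for c x
  proof (rule uniq[symmetric])
    have "c *\<^sub>C x - c *\<^sub>C P x = c *\<^sub>C (x - P x)"
      by (simp add: complex_vector.scale_right_diff_distrib)
    then show "c *\<^sub>C x - c *\<^sub>C P x \<in> ortho_compl M"
      using P sub complex_vector.subspace_scale by metis
  qed (use P sub complex_vector.subspace_scale in blast)
  moreover have "norm (P x) \<le> norm x * 1" for x
  proof -
    have "cinner (x - P x) (P x) = 0"
      using P by (auto simp: ortho_compl_def)
    from pythagoras[OF this] have "(norm (P x))\<^sup>2 \<le> (norm x)\<^sup>2"
      by simp
    then show ?thesis by (simp add: power2_le_imp_le[of "norm (P x)" "norm x"])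
  qed
  ultimately have P_ops: "P \<in> bounded_ops" by (intro bounded_opsI[of P 1]) auto
  have fix_M: "P m = m" if "m \<in> M" for m
    using uniq[of m m] that complex_vector.subspace_0[OF sub(2)] by simp
  have "cinner (P x) y = cinner x (P y)" for x y
  proof -
    have "cinner (P x) (y - P y) = 0"
      using P cinner_commute[of "P x" "y - P y"] by (simp add: ortho_compl_def)
    moreover have "cinner (x - P x) (P y) = 0"
      using P by (simp add: ortho_compl_def)
    ultimately show ?thesis by (simp add: cinner_diff_left cinner_diff_right)
  qed
  moreover have "P \<circ> P = P"
    using fix_M[OF P(1)] by (simp add: fun_eq_iff)
  ultimately have "P \<in> projections"
    using P_ops unfolding projections_def by blast
  moreover have "range P = M"
    using P(1) fix_M by (metis image_subset_iff rangeI subsetI subset_antisym)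
  ultimately show ?thesis by blast
qed

lemma proj_onto:
  fixes M :: "'a::chilbert_space set"
  assumes "closed_csubspace M"
  shows proj_onto_projections: "proj_onto M \<in> projections"
    and range_proj_onto: "range (proj_onto M) = M"
proof -
  obtain P where P: "P \<in> projections" "range P = M"
    using projection_onto_exists[OF assms] by blast
  have "proj_onto M = P"
    unfolding proj_onto_def
  proof (rule the_equality)
    fix Q :: "'a \<Rightarrow> 'a"
    assume Q: "Q \<in> projections \<and> range Q = M"
    show "Q = P"
      by (rule projections_eqI) (simp_all only: Q P)
  qed (simp add: P)
  then show "proj_onto M \<in> projections" "range (proj_onto M) = M"
    using P by simp_all
qed

lemma proj_perp_projections:
  assumes "P \<in> projections" shows "proj_perp P \<in> projections"
  using assms bounded_ops_minus[OF bounded_ops_id projections_bounded_ops[OF assms]]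
  by (auto simp: projections_def proj_perp_def cinner_diff_left cinner_diff_right fun_eq_iff
      bounded_ops_diff)

lemma range_proj_perp:
  assumes "P \<in> projections" shows "range (proj_perp P) = ortho_compl (range P)"
  using range_projection[OF proj_perp_projections[OF assms]]
  by (simp add: ortho_compl_range_projection[OF assms]) (simp add: proj_perp_def)

lemma proj_perp_proj_perp: "proj_perp (proj_perp P) = P"
  by (simp add: proj_perp_def)

lemma ortho_compl_ortho_compl:
  fixes M :: "'a::chilbert_space set"
  assumes "closed_csubspace M"
  shows "ortho_compl (ortho_compl M) = M"
  using range_proj_perp[of "proj_onto M"] range_proj_perp[of "proj_perp (proj_onto M)"]
    proj_perp_projections proj_onto[OF assms] by (metis proj_perp_proj_perp)

text \<open>
  By the hypotheses, \<open>T x = T (P x) + T (x - P x)\<close> is the decomposition of \<open>T x\<close> along the range of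
  \<open>Q\<close> and its orthogonal complement.
\<close>

lemma proj_intertwine:
  assumes M: "P \<in> projections" and K: "Q \<in> projections" and T: "T \<in> bounded_ops"
    and 1: "\<And>x. x \<in> range P \<Longrightarrow> T x \<in> range Q"
    and 2: "\<And>x. x \<in> ortho_compl (range P) \<Longrightarrow> T x \<in> ortho_compl (range Q)"
  shows "T (P x) = Q (T x)"
proof -
  have "Q (T (P x)) = T (P x)"
    using 1[of "P x"] in_range_projection_iff[OF K] by blast
  moreover have "Q (T (x - P x)) = 0"
    using 2[of "x - P x"] M K
    by (simp add: ortho_compl_range_projection bounded_ops_diff projections_bounded_ops
        projections_idem)
  ultimately show ?thesis
    using T K by (simp add: bounded_ops_diff projections_bounded_ops)
qed

lemma closed_span_ortho:
  assumes "\<And>a b. a \<in> A \<Longrightarrow> b \<in> B \<Longrightarrow> cinner a b = 0"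
    and x: "x \<in> closure (complex_vector.span A)" and y: "y \<in> closure (complex_vector.span B)"
  shows "cinner x (y :: 'a::complex_inner) = 0"
proof -
  have "A \<subseteq> ortho_compl B"
    using assms by (auto simp: ortho_compl_def)
  then have "x \<in> ortho_compl B"
    using closed_span_subset[OF _ closed_csubspace_ortho_compl] x by blast
  then have "cinner b x = 0" if "b \<in> B" for b
    using that cinner_commute[of b x] by (simp add: ortho_compl_def)
  then have "B \<subseteq> ortho_compl {x}"
    by (auto simp: ortho_compl_def)
  then have "y \<in> ortho_compl {x}"
    using closed_span_subset[OF _ closed_csubspace_ortho_compl] y by blast
  then show ?thesis
    using cinner_commute[of x y] by (simp add: ortho_compl_def)
qed


section \<open>Adjoints\<close>

text \<open>
  Let \<open>z\<close> be orthogonal to the kernel of \<open>f\<close> with \<open>f z \<noteq> 0\<close>. As \<open>f x \<cdot> z - f z \<cdot> x\<close> lies in the kernel,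
  its inner product with \<open>z\<close> vanishes, and this expresses \<open>f x\<close> by \<open>\<langle>x, z\<rangle>\<close>.
\<close>

lemma riesz_representation:
  fixes f :: "'a::chilbert_space \<Rightarrow> complex"
  assumes f: "f \<in> bounded_ops"
  shows "\<exists>z. \<forall>x. f x = cinner x z"
proof (cases "\<forall>x. f x = 0")
  case True
  then show ?thesis by (intro exI[of _ 0]) simp
next
  case False
  define M where "M = {x. f x \<in> {0}}"
  have "closed_csubspace {0 :: complex}" by simp
  then have M: "closed_csubspace M"
    unfolding M_def by (intro closed_csubspace_vimage[OF f])
  obtain x0 where x0: "f x0 \<noteq> 0" using False by blast
  obtain m where m: "m \<in> M" "x0 - m \<in> ortho_compl M"
    using closed_subspace_decomposition[OF M] by blast
  define z where "z = x0 - m"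
  have fz: "f z \<noteq> 0"
    using m x0 f by (simp add: z_def M_def bounded_ops_diff)
  then have nz: "cinner z z \<noteq> 0"
    using f by (auto simp: cinner_self_eq_0_iff)
  have "f x = cinner x ((cnj (f z) / cnj (cinner z z)) *\<^sub>C z)" for x
  proof -
    have "f x *\<^sub>C z - f z *\<^sub>C x \<in> M"
      using f by (simp add: M_def bounded_ops_simps scaleC_complex_def)
    then have "cinner z (f x *\<^sub>C z - f z *\<^sub>C x) = 0"
      using m by (simp add: z_def ortho_compl_def)
    then have "cinner (f x *\<^sub>C z - f z *\<^sub>C x) z = 0"
      using cinner_commute[of "f x *\<^sub>C z - f z *\<^sub>C x" z] by simp
    then have "f x * cinner z z = f z * cinner x z"
      by (simp add: cinner_linear_simps)
    then show ?thesis
      using nz by (simp add: cinner_scaleC_right field_simps)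
  qed
  then show ?thesis by blast
qed

lemma bounded_ops_cinner: "(\<lambda>x. cinner x y) \<in> bounded_ops"
  by (rule bounded_opsI[where K = "norm y"])
    (auto simp: cinner_linear_simps scaleC_complex_def cauchy_schwarz)

lemma cadjoint:
  fixes T :: "'a::chilbert_space \<Rightarrow> 'b::chilbert_space"
  assumes T: "T \<in> bounded_ops"
  shows "cinner (T x) y = cinner x (cadjoint T y)"
proof -
  have "\<exists>z. \<forall>x. cinner (T x) y = cinner x z" for y
    using riesz_representation[OF bounded_ops_comp[OF bounded_ops_cinner[of y] T]]
    by (simp add: comp_def)
  then obtain S where "\<And>y. \<forall>x. cinner (T x) y = cinner x (S y)"
    using choice[of "\<lambda>y z. \<forall>x. cinner (T x) y = cinner x z"] by blast
  then have "\<exists>S. \<forall>x y. cinner (T x) y = cinner x (S y)"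
    by blast
  from someI_ex[OF this] have "\<forall>x y. cinner (T x) y = cinner x (cadjoint T y)"
    unfolding cadjoint_def .
  then show ?thesis by blast
qed

lemma cadjoint':
  fixes T :: "'a::chilbert_space \<Rightarrow> 'b::chilbert_space"
  assumes T: "T \<in> bounded_ops"
  shows "cinner (cadjoint T y) x = cinner y (T x)"
  unfolding cinner_commute[of "cadjoint T y" x] cinner_commute[of y "T x"] cadjoint[OF T] ..

lemma cadjoint_bounded_ops:
  fixes T :: "'a::chilbert_space \<Rightarrow> 'b::chilbert_space"
  assumes T: "T \<in> bounded_ops"
  shows "cadjoint T \<in> bounded_ops"
proof (rule bounded_opsI)
  show "cadjoint T (x + y) = cadjoint T x + cadjoint T y" for x y
    by (rule cinner_ext) (simp add: cadjoint'[OF T] cinner_linear_simps)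
  show "cadjoint T (c *\<^sub>C x) = c *\<^sub>C cadjoint T x" for c x
    by (rule cinner_ext) (simp add: cadjoint'[OF T] cinner_linear_simps)
  fix y
  have "(norm (cadjoint T y))\<^sup>2 = Re (cinner y (T (cadjoint T y)))"
    by (simp add: norm_sq_cinner cadjoint'[OF T])
  also have "\<dots> \<le> norm y * norm (T (cadjoint T y))"
    by (rule Re_cinner_le)
  also have "\<dots> \<le> norm y * (onorm T * norm (cadjoint T y))"
    by (intro mult_left_mono bounded_ops_norm_le[OF T]) simp
  finally have "norm (cadjoint T y) * norm (cadjoint T y)
      \<le> (norm y * onorm T) * norm (cadjoint T y)"
    by (simp add: power2_eq_square mult.assoc)
  then show "norm (cadjoint T y) \<le> norm y * onorm T"
    using onorm_pos_le[OF bounded_ops_bounded_linear[OF T]]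
    by (cases "cadjoint T y = 0") (auto simp: mult_le_cancel_right)
qed

lemma maps_ortho_compl:
  fixes T :: "'a::chilbert_space \<Rightarrow> 'b::chilbert_space"
  assumes T: "T \<in> bounded_ops" and "\<And>y. y \<in> K \<Longrightarrow> cadjoint T y \<in> M"
    and "x \<in> ortho_compl M"
  shows "T x \<in> ortho_compl K"
  using assms by (auto simp: ortho_compl_def cadjoint[OF T])


section \<open>Suprema of projections and the maps of an operator space\<close>

lemma closed_csubspace_residual:
  assumes "\<U> \<subseteq> bounded_ops" "closed_csubspace M"
  shows "closed_csubspace {x. \<forall>S\<in>\<U>. S x \<in> M}"
proof -
  have "closed_csubspace (\<Inter>S\<in>\<U>. {x. S x \<in> M})"
    using assms by (intro closed_csubspace_INT closed_csubspace_vimage) auto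
  moreover have "{x. \<forall>S\<in>\<U>. S x \<in> M} = (\<Inter>S\<in>\<U>. {x. S x \<in> M})" by auto
  ultimately show ?thesis by simp
qed

lemma proj_Sup:
  fixes \<A> :: "('a::chilbert_space \<Rightarrow> 'a) set"
  assumes A: "\<A> \<subseteq> projections"
  shows proj_Sup_projections: "proj_Sup \<A> \<in> projections"
    and range_proj_Sup:
      "range (proj_Sup \<A>) = closure (complex_vector.span (\<Union>P\<in>\<A>. range P))"
proof -
  define R where "R = proj_onto (closure (complex_vector.span (\<Union>P\<in>\<A>. range P)))"
  note csub = closed_csubspace_closed_span[of "\<Union>P\<in>\<A>. range P"]
  have R: "R \<in> projections" "range R = closure (complex_vector.span (\<Union>P\<in>\<A>. range P))"
    unfolding R_def by (rule proj_onto[OF csub])+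
  have upper: "\<forall>P\<in>\<A>. P \<le>\<^sub>p R"
    using subset_closed_span[of "\<Union>P\<in>\<A>. range P"] unfolding proj_le_def R by blast
  have least: "\<forall>Q\<in>projections. (\<forall>P\<in>\<A>. P \<le>\<^sub>p Q) \<longrightarrow> R \<le>\<^sub>p Q"
    unfolding proj_le_def R
    by (intro ballI impI closed_span_subset closed_csubspace_range_projection) blast+
  have "proj_Sup \<A> = R"
    unfolding proj_Sup_def
  proof (rule the_equality)
    show "R \<in> projections \<and> (\<forall>P\<in>\<A>. P \<le>\<^sub>p R) \<and>
        (\<forall>Q\<in>projections. (\<forall>P\<in>\<A>. P \<le>\<^sub>p Q) \<longrightarrow> R \<le>\<^sub>p Q)"
      using R upper least by blast
    fix R'
    assume R': "R' \<in> projections \<and> (\<forall>P\<in>\<A>. P \<le>\<^sub>p R') \<and>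
        (\<forall>Q\<in>projections. (\<forall>P\<in>\<A>. P \<le>\<^sub>p Q) \<longrightarrow> R' \<le>\<^sub>p Q)"
    then have "R' \<le>\<^sub>p R" "R \<le>\<^sub>p R'"
      using R upper least by blast+
    then have "range R' = range R"
      unfolding proj_le_def by blast
    then show "R' = R"
      using projections_eqI R R' by blast
  qed
  then show "proj_Sup \<A> \<in> projections"
    "range (proj_Sup \<A>) = closure (complex_vector.span (\<Union>P\<in>\<A>. range P))"
    using R by simp_all
qed

lemma proj_Sup_upper:
  fixes \<A> :: "('a::chilbert_space \<Rightarrow> 'a) set"
  assumes "\<A> \<subseteq> projections" "P \<in> \<A>"
  shows "range P \<subseteq> range (proj_Sup \<A>)"
  using assms subset_closed_span[of "\<Union>P\<in>\<A>. range P"] unfolding range_proj_Sup[OF assms(1)]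
  by blast

lemma proj_Sup_least:
  fixes \<A> :: "('a::chilbert_space \<Rightarrow> 'a) set"
  assumes "\<A> \<subseteq> projections" "closed_csubspace M" "\<And>P. P \<in> \<A> \<Longrightarrow> range P \<subseteq> M"
  shows "range (proj_Sup \<A>) \<subseteq> M"
  unfolding range_proj_Sup[OF assms(1)] using assms
  by (intro closed_span_subset) blast+

lemma Map_projections:
  fixes \<U> :: "('a::chilbert_space \<Rightarrow> 'b::chilbert_space) set"
  shows "Map \<U> P \<in> projections"
  unfolding Map_def by (intro proj_onto closed_csubspace_closed_span)

lemma range_Map:
  fixes \<U> :: "('a::chilbert_space \<Rightarrow> 'b::chilbert_space) set"
  shows "range (Map \<U> P) = closure (complex_vector.span {S x | S x. S \<in> \<U> \<and> x \<in> range P})"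
  unfolding Map_def by (intro proj_onto closed_csubspace_closed_span)

lemma in_range_Map:
  fixes \<U> :: "('a::chilbert_space \<Rightarrow> 'b::chilbert_space) set"
  assumes "S \<in> \<U>" "x \<in> range P"
  shows "S x \<in> range (Map \<U> P)"
  using subset_closed_span[of "{S x | S x. S \<in> \<U> \<and> x \<in> range P}"] assms
  unfolding range_Map by blast

lemma range_Map_subset:
  fixes \<U> :: "('a::chilbert_space \<Rightarrow> 'b::chilbert_space) set"
  assumes "closed_csubspace M" "\<And>S x. S \<in> \<U> \<Longrightarrow> x \<in> range P \<Longrightarrow> S x \<in> M"
  shows "range (Map \<U> P) \<subseteq> M"
  unfolding range_Map using assms by (intro closed_span_subset) auto

text \<open>
  \<open>Map \<U> P \<le> Q\<close> holds if and only if the range of \<open>P\<close> is contained in the closed subspace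
  \<open>{x. \<U> x \<subseteq> Q}\<close>. A map with such a residual preserves suprema.
\<close>

lemma Map_in_sup_maps:
  fixes \<U> :: "('a::chilbert_space \<Rightarrow> 'b::chilbert_space) set"
  assumes U: "\<U> \<subseteq> bounded_ops"
  shows "Map \<U> \<in> sup_maps"
  unfolding sup_maps_def
proof (intro CollectI conjI allI impI)
  show "Map \<U> \<in> projections \<rightarrow> projections"
    by (simp add: Map_projections)
  have "range (Map \<U> (\<lambda>_. 0)) \<subseteq> {0}"
    using U by (intro range_Map_subset) auto
  then show "Map \<U> (\<lambda>_. 0) = (\<lambda>_. 0)"
    by (auto simp: fun_eq_iff)
  fix \<A> :: "('a \<Rightarrow> 'a) set"
  assume A: "\<A> \<subseteq> projections"
  have MA: "Map \<U> ` \<A> \<subseteq> projections"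
    using Map_projections by blast
  show "Map \<U> (proj_Sup \<A>) = proj_Sup (Map \<U> ` \<A>)"
  proof (rule projections_eqI[OF Map_projections proj_Sup_projections[OF MA]], rule subset_antisym)
    let ?M = "range (proj_Sup (Map \<U> ` \<A>))"
    have M: "closed_csubspace ?M"
      by (rule closed_csubspace_range_projection[OF proj_Sup_projections[OF MA]])
    have "range (proj_Sup \<A>) \<subseteq> {x. \<forall>S\<in>\<U>. S x \<in> ?M}"
    proof (rule proj_Sup_least[OF A closed_csubspace_residual[OF U M]])
      fix P assume P: "P \<in> \<A>"
      then have "range (Map \<U> P) \<subseteq> ?M"
        by (intro proj_Sup_upper[OF MA]) blast
      then show "range P \<subseteq> {x. \<forall>S\<in>\<U>. S x \<in> ?M}"
        using in_range_Map[of _ \<U> _ P] by blast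
    qed
    then show "range (Map \<U> (proj_Sup \<A>)) \<subseteq> ?M"
      by (intro range_Map_subset[OF M]) blast
    show "?M \<subseteq> range (Map \<U> (proj_Sup \<A>))"
    proof (rule proj_Sup_least[OF MA closed_csubspace_range_projection[OF Map_projections]])
      fix Q assume "Q \<in> Map \<U> ` \<A>"
      then obtain P where P: "P \<in> \<A>" "Q = Map \<U> P" by blast
      show "range Q \<subseteq> range (Map \<U> (proj_Sup \<A>))"
        unfolding P(2)
        using proj_Sup_upper[OF A P(1)]
        by (intro range_Map_subset closed_csubspace_range_projection[OF Map_projections]
            in_range_Map) auto
    qed
  qed
qed

lemma sup_map_projections: "\<phi> \<in> sup_maps \<Longrightarrow> P \<in> projections \<Longrightarrow> \<phi> P \<in> projections"
  by (auto simp: sup_maps_def)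

lemma semilattice1_projections:
  assumes "(L :: 'a::chilbert_space \<Rightarrow> 'a) \<in> semilattice1 \<phi>"
  shows "L \<in> projections"
  using assms unfolding semilattice1_def by (auto intro: proj_Sup_projections)

text \<open>
  Every projection \<open>P\<close> has an upper bound in the semi-lattice on which \<open>\<phi>\<close> takes the same value,
  namely the largest projection that \<open>\<phi>\<close> maps below \<open>\<phi> P\<close>. Hence a condition on \<open>P\<close> and \<open>\<phi> P\<close> that
  passes to smaller \<open>P\<close> with the same \<open>\<phi> P\<close> needs to be tested on the semi-lattice only.
\<close>

lemma semilattice1_cofinal:
  fixes \<phi> :: "('a::chilbert_space \<Rightarrow> 'a) \<Rightarrow> ('b::chilbert_space \<Rightarrow> 'b)"
  assumes phi: "\<phi> \<in> sup_maps" and P: "P \<in> projections"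
  obtains L where "L \<in> semilattice1 \<phi>" "range P \<subseteq> range L" "\<phi> L = \<phi> P"
proof
  define \<A> where "\<A> = {P' \<in> projections. \<phi> P' \<le>\<^sub>p \<phi> P}"
  have A: "\<A> \<subseteq> projections" "P \<in> \<A>"
    using P by (auto simp: \<A>_def proj_le_def)
  show "proj_Sup \<A> \<in> semilattice1 \<phi>"
    using sup_map_projections[OF phi P] by (auto simp: semilattice1_def \<A>_def)
  show "range P \<subseteq> range (proj_Sup \<A>)"
    using A by (rule proj_Sup_upper)
  have pA: "\<phi> ` \<A> \<subseteq> projections"
    using A sup_map_projections[OF phi] by blast
  have eq: "\<phi> (proj_Sup \<A>) = proj_Sup (\<phi> ` \<A>)"
    using phi A by (simp add: sup_maps_def)
  have "range (proj_Sup (\<phi> ` \<A>)) \<subseteq> range (\<phi> P)"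
    using pA by (rule proj_Sup_least)
      (auto simp: \<A>_def proj_le_def closed_csubspace_range_projection[OF sup_map_projections[OF phi P]])
  moreover have "range (\<phi> P) \<subseteq> range (proj_Sup (\<phi> ` \<A>))"
    using A by (intro proj_Sup_upper[OF pA]) blast
  ultimately show "\<phi> (proj_Sup \<A>) = \<phi> P"
    unfolding eq
    by (intro projections_eqI proj_Sup_projections[OF pA] sup_map_projections[OF phi P]) blast
qed


section \<open>Intertwiners and ortho-maps\<close>

lemma Op_iff:
  "T \<in> Op \<phi> \<longleftrightarrow> T \<in> bounded_ops \<and> (\<forall>P\<in>projections. \<forall>x. \<phi> P (T (P x)) = T (P x))"
  by (auto simp: Op_def proj_perp_def fun_eq_iff)

lemma intertwiners_iff:
  "T \<in> intertwiners \<phi> \<longleftrightarrow> T \<in> bounded_ops \<and> (\<forall>L\<in>semilattice1 \<phi>. \<forall>x. T (L x) = \<phi> L (T x))"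
  by (auto simp: intertwiners_def fun_eq_iff)

text \<open>
  The space in the definition of \<open>\<phi>\<^sup>\<bottom>\<close> is reflexive because it is given by conditions
  \<open>T (L\<^sup>\<bottom>) \<subseteq> ker (\<phi> L)\<close> with closed subspaces on both sides.
\<close>

lemma Op_map_perp:
  fixes \<phi> :: "('a::chilbert_space \<Rightarrow> 'a) \<Rightarrow> ('b::chilbert_space \<Rightarrow> 'b)"
  assumes phi: "\<phi> \<in> sup_maps"
  shows "Op (map_perp \<phi>) = {T \<in> bounded_ops. \<forall>L\<in>semilattice1 \<phi>. \<forall>x. \<phi> L (T (x - L x)) = 0}"
proof -
  define \<V> where "\<V> = {T \<in> bounded_ops. \<forall>L\<in>semilattice1 \<phi>. \<forall>x. \<phi> L (T (x - L x)) = 0}"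
  have V: "map_perp \<phi> = Map \<V>"
    by (simp add: map_perp_def \<V>_def fun_eq_iff proj_perp_def)
  have "T \<in> \<V>" if T: "T \<in> Op (Map \<V>)" for T
    unfolding \<V>_def
  proof (intro CollectI conjI ballI allI)
    fix L x assume L: "L \<in> semilattice1 \<phi>"
    have "closed_csubspace {y. \<phi> L y \<in> {0}}"
      using sup_map_projections[OF phi semilattice1_projections[OF L]]
      by (intro closed_csubspace_vimage projections_bounded_ops) auto
    moreover have "S y \<in> {y. \<phi> L y \<in> {0}}" if S: "S \<in> \<V>" and "y \<in> range (proj_perp L)" for S y
      using that L by (auto simp: \<V>_def proj_perp_def)
    ultimately have "range (Map \<V> (proj_perp L)) \<subseteq> {y. \<phi> L y \<in> {0}}"
      by (rule range_Map_subset)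
    moreover have "Map \<V> (proj_perp L) (T (proj_perp L x)) = T (proj_perp L x)"
      using T proj_perp_projections[OF semilattice1_projections[OF L]] by (simp add: Op_iff)
    then have "T (proj_perp L x) \<in> range (Map \<V> (proj_perp L))"
      by (metis rangeI)
    ultimately show "\<phi> L (T (x - L x)) = 0"
      by (auto simp: proj_perp_def)
  qed (use T in \<open>simp add: Op_iff\<close>)
  moreover have "T \<in> Op (Map \<V>)" if T: "T \<in> \<V>" for T
    unfolding Op_iff
  proof (intro conjI ballI allI)
    fix P x
    show "Map \<V> P (T (P x)) = T (P x)"
      by (rule in_range_projection_iff[OF Map_projections, THEN iffD1])
        (intro in_range_Map[OF T] rangeI)
  qed (use T in \<open>simp add: \<V>_def\<close>)
  ultimately show ?thesis
    unfolding V \<V>_def[symmetric] by blast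
qed

lemma intertwiners_eq_Op_Int:
  fixes \<phi> :: "('a::chilbert_space \<Rightarrow> 'a) \<Rightarrow> ('b::chilbert_space \<Rightarrow> 'b)"
  assumes phi: "\<phi> \<in> sup_maps"
  shows "intertwiners \<phi> = Op \<phi> \<inter> Op (map_perp \<phi>)"
proof (intro set_eqI iffI)
  fix T assume T: "T \<in> intertwiners \<phi>"
  then have T_ops: "T \<in> bounded_ops" and TL: "\<And>L x. L \<in> semilattice1 \<phi> \<Longrightarrow> T (L x) = \<phi> L (T x)"
    by (auto simp: intertwiners_iff)
  have "\<phi> P (T (P x)) = T (P x)" if P: "P \<in> projections" for P x
  proof -
    obtain L where L: "L \<in> semilattice1 \<phi>" "range P \<subseteq> range L" "\<phi> L = \<phi> P"
      using semilattice1_cofinal[OF phi P] by blast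
    then have "L (P x) = P x"
      using in_range_projection_iff[OF semilattice1_projections[OF L(1)]] by blast
    then show ?thesis
      using TL[OF L(1), of "P x"] L(3) by simp
  qed
  moreover have "\<phi> L (T (x - L x)) = 0" if L: "L \<in> semilattice1 \<phi>" for L x
    using TL[OF L, of "x - L x", symmetric] semilattice1_projections[OF L] T_ops
    by (simp add: bounded_ops_diff projections_bounded_ops projections_idem)
  ultimately show "T \<in> Op \<phi> \<inter> Op (map_perp \<phi>)"
    unfolding Op_map_perp[OF phi] Op_iff[of T \<phi>] Int_iff mem_Collect_eq using T_ops by blast
next
  fix T assume "T \<in> Op \<phi> \<inter> Op (map_perp \<phi>)"
  then have T_ops: "T \<in> bounded_ops"
    and 1: "\<And>P x. P \<in> projections \<Longrightarrow> \<phi> P (T (P x)) = T (P x)"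
    and 2: "\<And>L x. L \<in> semilattice1 \<phi> \<Longrightarrow> \<phi> L (T (x - L x)) = 0"
    unfolding Op_map_perp[OF phi] by (auto simp: Op_iff[of T \<phi>])
  have "T (L x) = \<phi> L (T x)" if L: "L \<in> semilattice1 \<phi>" for L x
    using 1[OF semilattice1_projections[OF L], of x] 2[OF L, of x] T_ops
      projections_bounded_ops[OF sup_map_projections[OF phi semilattice1_projections[OF L]]]
    by (simp add: bounded_ops_diff)
  then show "T \<in> intertwiners \<phi>"
    using T_ops by (simp add: intertwiners_iff)
qed

text \<open>
  Taking adjoints in \<open>B L = \<phi>(L) B\<close> gives \<open>B\<^sup>* \<phi>(L) = L B\<^sup>*\<close>, so that \<open>L\<close> can be moved through the product
  \<open>A B\<^sup>* C\<close>.
\<close>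

lemma normalizing_intertwiners:
  fixes \<phi> :: "('a::chilbert_space \<Rightarrow> 'a) \<Rightarrow> ('b::chilbert_space \<Rightarrow> 'b)"
  assumes phi: "\<phi> \<in> sup_maps"
  shows "normalizing (intertwiners \<phi>)"
  unfolding normalizing_def operator_space_def
proof (intro conjI ballI allI)
  have L_ops: "L \<in> projections" "\<phi> L \<in> projections" if "L \<in> semilattice1 \<phi>" for L
    using that semilattice1_projections sup_map_projections[OF phi] by blast+
  have pL_ops: "\<phi> L \<in> bounded_ops" if "L \<in> semilattice1 \<phi>" for L
    using L_ops[OF that] projections_bounded_ops by blast
  show "intertwiners \<phi> \<subseteq> bounded_ops"
    by (auto simp: intertwiners_def)
  show "(\<lambda>_. 0) \<in> intertwiners \<phi>"
    by (auto simp: intertwiners_iff bounded_ops_zero pL_ops)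
  show "(\<lambda>x. S x + T x) \<in> intertwiners \<phi>"
    if "S \<in> intertwiners \<phi>" "T \<in> intertwiners \<phi>" for S T
    using that by (simp add: intertwiners_iff bounded_ops_plus bounded_ops_add pL_ops)
  show "(\<lambda>x. c *\<^sub>C T x) \<in> intertwiners \<phi>" if "T \<in> intertwiners \<phi>" for c T
    using that by (simp add: intertwiners_iff bounded_ops_scale bounded_ops_scaleC pL_ops)
  fix A B C
  assume A: "A \<in> intertwiners \<phi>" and B: "B \<in> intertwiners \<phi>" and C: "C \<in> intertwiners \<phi>"
  then have B_ops: "B \<in> bounded_ops"
    by (simp add: intertwiners_iff)
  have "cadjoint B (\<phi> L y) = L (cadjoint B y)" if L: "L \<in> semilattice1 \<phi>" for L y
  proof (rule cinner_ext)
    fix x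
    show "cinner (cadjoint B (\<phi> L y)) x = cinner (L (cadjoint B y)) x"
      using B L L_ops[OF L]
      by (simp add: cadjoint'[OF B_ops] projections_cinner intertwiners_iff)
  qed
  then show "A \<circ> cadjoint B \<circ> C \<in> intertwiners \<phi>"
    using A C B_ops unfolding intertwiners_iff
    by (auto intro!: bounded_ops_comp cadjoint_bounded_ops)
qed

text \<open>
  An element \<open>T\<close> of \<open>Op \<psi>\<close> maps \<open>L\<^sup>\<bottom>\<close> into \<open>\<psi>(L\<^sup>\<bottom>)\<close>, which is orthogonal to \<open>\<psi>(L)\<close>. This is
  \<open>\<psi>(L) T L\<^sup>\<bottom> = 0\<close>, the condition for \<open>Op \<psi>\<^sup>\<bottom>\<close>.
\<close>

lemma Op_ortho_map:
  fixes \<psi> :: "('a::chilbert_space \<Rightarrow> 'a) \<Rightarrow> ('b::chilbert_space \<Rightarrow> 'b)"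
  assumes chi: "ortho_map \<psi>"
  shows "Op \<psi> = intertwiners \<psi>"
proof (intro subset_antisym subsetI)
  have sup: "\<psi> \<in> sup_maps"
    using chi by (simp add: ortho_map_def)
  show "T \<in> Op \<psi>" if "T \<in> intertwiners \<psi>" for T
    using that intertwiners_eq_Op_Int[OF sup] by blast
  fix T assume T: "T \<in> Op \<psi>"
  then have T_ops: "T \<in> bounded_ops"
    and T': "\<And>P x. P \<in> projections \<Longrightarrow> \<psi> P (T (P x)) = T (P x)"
    by (auto simp: Op_iff)
  have "\<psi> L (T (x - L x)) = 0" if L: "L \<in> semilattice1 \<psi>" for L x
  proof -
    note Lp = semilattice1_projections[OF L]
    have "T (proj_perp L x) \<in> range (\<psi> (proj_perp L))"
      using T'[OF proj_perp_projections[OF Lp]] by (metis rangeI)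
    moreover have "proj_orthogonal (\<psi> L) (\<psi> (proj_perp L))"
      using chi L by (simp add: ortho_map_def)
    ultimately have "\<forall>y\<in>range (\<psi> L). cinner y (T (proj_perp L x)) = 0"
      unfolding proj_orthogonal_def by blast
    then have "cinner (\<psi> L (T (proj_perp L x))) (\<psi> L (T (proj_perp L x))) = 0"
      using sup_map_projections[OF sup Lp] by (metis projections_cinner projections_idem rangeI)
    then show ?thesis
      by (simp add: cinner_self_eq_0_iff proj_perp_def)
  qed
  then have "T \<in> Op (map_perp \<psi>)"
    using T_ops by (simp add: Op_map_perp[OF sup])
  then show "T \<in> intertwiners \<psi>"
    using T intertwiners_eq_Op_Int[OF sup] by blast
qed

text \<open>
  The members of the semi-lattice of \<open>Map \<U>\<close> are the residuals \<open>{x. \<U> x \<subseteq> Q}\<close>. If \<open>\<U>\<close> is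
  normalizing, such a residual is invariant under \<open>T\<^sup>* S\<close> for all \<open>S, T \<in> \<U>\<close>, because
  \<open>R T\<^sup>* S \<in> \<U>\<close> for \<open>R \<in> \<U>\<close>; this is \<open>\<langle>S x, T y\<rangle> = \<langle>T\<^sup>* S x, y\<rangle> = 0\<close> for \<open>x \<in> L\<close> and \<open>y \<bottom> L\<close>.
\<close>

lemma ortho_map_Map:
  fixes \<U> :: "('a::chilbert_space \<Rightarrow> 'b::chilbert_space) set"
  assumes norm: "normalizing \<U>"
  shows "ortho_map (Map \<U>)"
proof -
  have U: "\<U> \<subseteq> bounded_ops"
    using norm by (simp add: normalizing_def operator_space_def)
  have triple: "R (cadjoint T (S x)) = (R \<circ> cadjoint T \<circ> S) x" for R S x
    and T :: "'a \<Rightarrow> 'b" by simp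
  have "proj_orthogonal (Map \<U> L) (Map \<U> (proj_perp L))"
    if L: "L \<in> semilattice1 (Map \<U>)" for L
  proof -
    note Lp = semilattice1_projections[OF L]
    obtain Q where Q: "Q \<in> projections" "L = proj_Sup {P \<in> projections. Map \<U> P \<le>\<^sub>p Q}"
      using L by (auto simp: semilattice1_def)
    define \<A> where "\<A> = {P \<in> projections. Map \<U> P \<le>\<^sub>p Q}"
    have A: "\<A> \<subseteq> projections" "L = proj_Sup \<A>"
      using Q by (auto simp: \<A>_def)
    note Qc = closed_csubspace_range_projection[OF Q(1)]
    define M where "M = {x. \<forall>S\<in>\<U>. S x \<in> range Q}"
    have M: "closed_csubspace M"
      unfolding M_def by (rule closed_csubspace_residual[OF U Qc])
    have "range L = M"
    proof
      show "range L \<subseteq> M"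
        unfolding A(2)
      proof (rule proj_Sup_least[OF A(1) M])
        fix P assume "P \<in> \<A>"
        then have "range (Map \<U> P) \<subseteq> range Q"
          by (simp add: \<A>_def proj_le_def)
        then show "range P \<subseteq> M"
          unfolding M_def using in_range_Map[of _ \<U> _ P] by blast
      qed
      have "range (Map \<U> (proj_onto M)) \<subseteq> range Q"
        by (rule range_Map_subset[OF Qc]) (simp only: range_proj_onto[OF M], simp add: M_def)
      then have "proj_onto M \<in> \<A>"
        using proj_onto_projections[OF M] by (simp add: \<A>_def proj_le_def)
      then show "M \<subseteq> range L"
        using proj_Sup_upper[OF A(1)] A(2) range_proj_onto[OF M] by blast
    qed
    have "cinner a b = 0"
      if a: "a \<in> {S x | S x. S \<in> \<U> \<and> x \<in> range L}"
        and b: "b \<in> {S x | S x. S \<in> \<U> \<and> x \<in> range (proj_perp L)}" for a b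
    proof -
      obtain S x where S: "a = S x" "S \<in> \<U>" "x \<in> M"
        using a \<open>range L = M\<close> by blast
      obtain T y where T: "b = T y" "T \<in> \<U>" "y \<in> ortho_compl M"
        using b range_proj_perp[OF Lp] \<open>range L = M\<close> by blast
      have "R (cadjoint T (S x)) \<in> range Q" if "R \<in> \<U>" for R
        using norm S T that unfolding triple normalizing_def M_def by blast
      then have "cadjoint T (S x) \<in> M"
        by (simp add: M_def)
      then have "cinner y (cadjoint T (S x)) = 0"
        using T by (simp add: ortho_compl_def)
      then have "cinner (T y) (S x) = 0"
        using cadjoint[of T y "S x"] T(2) U by auto
      then show ?thesis
        using S T cinner_commute[of "S x" "T y"] by simp
    qed
    then show ?thesis
      unfolding proj_orthogonal_def range_Map by (blast intro: closed_span_ortho)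
  qed
  then show ?thesis
    using Map_in_sup_maps[OF U] by (simp add: ortho_map_def)
qed


section \<open>Spectral subspaces of positive operators\<close>

definition selfadjoint :: "('a::complex_inner \<Rightarrow> 'a) \<Rightarrow> bool"
  where "selfadjoint A \<longleftrightarrow> A \<in> bounded_ops \<and> (\<forall>x y. cinner (A x) y = cinner x (A y))"

definition positive_op :: "('a::complex_inner \<Rightarrow> 'a) \<Rightarrow> bool"
  where "positive_op A \<longleftrightarrow> selfadjoint A \<and> (\<forall>x. 0 \<le> Re (cinner (A x) x))"

lemma selfadjoint_bounded_ops: "selfadjoint A \<Longrightarrow> A \<in> bounded_ops"
  by (simp add: selfadjoint_def)

lemma selfadjoint_cinner: "selfadjoint A \<Longrightarrow> cinner (A x) y = cinner x (A y)"
  by (simp add: selfadjoint_def)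

lemma funpow_bounded_ops:
  "(A :: 'a::complex_inner \<Rightarrow> 'a) \<in> bounded_ops \<Longrightarrow> A ^^ n \<in> bounded_ops"
proof (induction n)
  case 0
  have "A ^^ 0 = (\<lambda>x. x)" by auto
  then show ?case using bounded_ops_id by metis
next
  case (Suc n)
  then show ?case using bounded_ops_comp[of A "A ^^ n"] by (simp add: comp_def)
qed

lemma funpow_selfadjoint:
  assumes "selfadjoint A"
  shows "cinner ((A ^^ n) x) y = cinner x ((A ^^ n) y)"
proof (induction n arbitrary: y)
  case (Suc n)
  have "cinner ((A ^^ Suc n) x) y = cinner ((A ^^ n) x) (A y)"
    using selfadjoint_cinner[OF assms] by simp
  also have "\<dots> = cinner x ((A ^^ Suc n) y)"
    unfolding Suc by (simp add: funpow_swap1)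
  finally show ?case .
qed simp

lemma funpow_moment:
  assumes "selfadjoint A"
  shows "cinner ((A ^^ m) x) ((A ^^ n) x) = cinner ((A ^^ (n + m)) x) x"
  using funpow_selfadjoint[OF assms, of n "(A ^^ m) x" x] by (simp add: funpow_add)

lemma funpow_positive:
  assumes A: "positive_op A"
  shows "0 \<le> Re (cinner ((A ^^ n) x) x)"
proof (induction n arbitrary: x rule: nat_induct2)
  case 0
  then show ?case by (simp add: cinner_self_nonneg)
next
  case 1
  then show ?case using A by (simp add: positive_op_def)
next
  case (step n)
  have "cinner ((A ^^ (n + 2)) x) x = cinner (A ((A ^^ n) (A x))) x"
    by (simp add: funpow_swap1)
  also have "\<dots> = cinner ((A ^^ n) (A x)) (A x)"
    using A by (simp add: positive_op_def selfadjoint_cinner)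
  finally show ?case using step by simp
qed

text \<open>
  For a positive operator \<open>A\<close> these are the vectors in the range of the spectral projection of
  \<open>A\<close> for the interval \<open>[0, 1]\<close>. In this form an operator \<open>S\<close> with \<open>S A = B S\<close> visibly maps the
  spectral subspace of \<open>A\<close> into that of \<open>B\<close>.
\<close>

definition bounded_orbit :: "('a::complex_inner \<Rightarrow> 'a) \<Rightarrow> 'a set"
  where "bounded_orbit A = {u. \<exists>C. \<forall>n. norm ((A ^^ n) u) \<le> C}"

lemma bounded_orbit_intertwine:
  assumes S: "S \<in> bounded_ops" and SA: "\<And>x. S (A x) = B (S x)" and u: "u \<in> bounded_orbit A"
  shows "S u \<in> bounded_orbit B"
proof -
  obtain C where C: "\<And>n. norm ((A ^^ n) u) \<le> C"
    using u by (auto simp: bounded_orbit_def)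
  have "(B ^^ n) (S u) = S ((A ^^ n) u)" for n
    by (induction n) (simp_all add: SA)
  then have "norm ((B ^^ n) (S u)) \<le> onorm S * C" for n
    using bounded_ops_norm_le[OF S, of "(A ^^ n) u"] C[of n]
      onorm_pos_le[OF bounded_ops_bounded_linear[OF S]]
    by (metis mult_left_mono order_trans)
  then show ?thesis
    by (auto simp: bounded_orbit_def)
qed

text \<open>
  The sequence \<open>\<parallel>A\<^sup>n u\<parallel>\<close> is logarithmically convex, since
  \<open>\<parallel>A x\<parallel>\<^sup>2 = \<langle>x, A\<^sup>2 x\<rangle> \<le> \<parallel>x\<parallel> \<parallel>A\<^sup>2 x\<parallel>\<close>. If it ever grows, then it grows geometrically.
\<close>

lemma bounded_orbit_contract:
  assumes A: "selfadjoint A" and u: "u \<in> bounded_orbit A"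
  shows "norm (A u) \<le> norm u"
proof (rule ccontr)
  assume "\<not> norm (A u) \<le> norm u"
  then have gt: "norm u < norm (A u)" by simp
  define a where "a n = norm ((A ^^ n) u)" for n
  have u0: "0 < norm u"
    using gt selfadjoint_bounded_ops[OF A] by (cases "u = 0") auto
  define \<rho> where "\<rho> = norm (A u) / norm u"
  have rho: "\<rho> > 1"
    using gt u0 by (simp add: \<rho>_def)
  have logconvex: "(a (Suc n))\<^sup>2 \<le> a n * a (Suc (Suc n))" for n
  proof -
    have "(a (Suc n))\<^sup>2 = Re (cinner ((A ^^ n) u) (A (A ((A ^^ n) u))))"
      using A by (simp add: a_def norm_sq_cinner selfadjoint_cinner)
    then show ?thesis
      using Re_cinner_le by (simp add: a_def)
  qed
  have step: "0 < a n \<and> \<rho> * a n \<le> a (Suc n)" for n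
  proof (induction n)
    case 0
    then show ?case using u0 by (simp add: a_def \<rho>_def)
  next
    case (Suc n)
    then have pos: "0 < a (Suc n)"
      using rho by (smt (verit) mult_pos_pos)
    have "\<rho> * a (Suc n) * a n \<le> a (Suc n) * a (Suc n)"
      using Suc pos by (simp add: mult.commute mult.left_commute)
    also have "\<dots> \<le> a (Suc (Suc n)) * a n"
      using logconvex[of n] by (simp add: power2_eq_square mult.commute)
    finally show ?case
      using Suc pos by simp
  qed
  have grow: "\<rho> ^ n * a 0 \<le> a n" for n
  proof (induction n)
    case (Suc n)
    have "\<rho> ^ Suc n * a 0 \<le> \<rho> * a n"
      using Suc rho by (simp add: mult.assoc)
    then show ?case using step[of n] by linarith
  qed simp
  obtain C where C: "\<And>n. a n \<le> C"
    using u by (auto simp: bounded_orbit_def a_def)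
  obtain n where "C / a 0 < \<rho> ^ n"
    using real_arch_pow[OF rho] by blast
  then have "C < \<rho> ^ n * a 0"
    using step[of 0] by (simp add: pos_divide_less_eq)
  then show False
    using grow[of n] C[of n] by linarith
qed

text \<open>
  The left-hand side is a linear condition on \<open>u\<close> and the right-hand side a closed one.
\<close>

lemma bounded_orbit_iff:
  assumes A: "selfadjoint A"
  shows "u \<in> bounded_orbit A \<longleftrightarrow> (\<forall>n. norm ((A ^^ n) u) \<le> norm u)"
proof
  assume u: "u \<in> bounded_orbit A"
  have "(A ^^ m) ((A ^^ n) u) = (A ^^ (m + n)) u" for m n
    by (simp add: funpow_add)
  then have orb: "(A ^^ n) u \<in> bounded_orbit A" for n
    using u by (auto simp: bounded_orbit_def)
  show "\<forall>n. norm ((A ^^ n) u) \<le> norm u"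
  proof
    fix n show "norm ((A ^^ n) u) \<le> norm u"
    proof (induction n)
      case (Suc n)
      then show ?case
        using bounded_orbit_contract[OF A orb[of n]] by simp
    qed simp
  qed
qed (auto simp: bounded_orbit_def)

lemma closed_csubspace_bounded_orbit:
  assumes A: "selfadjoint A"
  shows "closed_csubspace (bounded_orbit A)"
proof
  note An = funpow_bounded_ops[OF selfadjoint_bounded_ops[OF A]]
  have "bounded_orbit A = (\<Inter>n. {u. norm ((A ^^ n) u) \<le> norm u})"
    using bounded_orbit_iff[OF A] by auto
  then show "closed (bounded_orbit A)"
    using An by (auto intro!: closed_INT closed_Collect_le continuous_intros continuous_on_bounded_ops)
  show "complex_vector.subspace (bounded_orbit A)"
    unfolding complex_vector.subspace_def
  proof (intro conjI ballI allI)
    show "0 \<in> bounded_orbit A"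
      using An by (auto simp: bounded_orbit_def)
    fix x y assume "x \<in> bounded_orbit A" "y \<in> bounded_orbit A"
    then obtain C D where CD: "\<And>n. norm ((A ^^ n) x) \<le> C" "\<And>n. norm ((A ^^ n) y) \<le> D"
      by (auto simp: bounded_orbit_def)
    have "norm ((A ^^ n) (x + y)) \<le> C + D" for n
      unfolding bounded_ops_add[OF An]
      using CD[of n] norm_triangle_ineq[of "(A ^^ n) x" "(A ^^ n) y"] by linarith
    then show "x + y \<in> bounded_orbit A"
      by (auto simp: bounded_orbit_def)
  next
    fix c x assume "x \<in> bounded_orbit A"
    then show "c *\<^sub>C x \<in> bounded_orbit A"
      by (simp add: bounded_orbit_iff[OF A] bounded_ops_scaleC[OF An] norm_scaleC mult_left_mono)
  qed
qed

lemma bounded_orbit_upper: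
  assumes "selfadjoint A" "u \<in> bounded_orbit A"
  shows "Re (cinner (A u) u) \<le> (norm u)\<^sup>2"
  using Re_cinner_le[of "A u" u] mult_right_mono[OF bounded_orbit_contract[OF assms], of "norm u"]
  by (simp add: power2_eq_square)

text \<open>
  Coercivity makes \<open>B\<close> bounded below, so its range is closed. A vector \<open>z\<close> orthogonal to the range
  satisfies \<open>\<langle>B z, z\<rangle> = 0\<close> and therefore vanishes.
\<close>

lemma coercive_surj:
  fixes B :: "'a::chilbert_space \<Rightarrow> 'a"
  assumes B: "selfadjoint B" and coercive: "\<And>x. (norm x)\<^sup>2 \<le> Re (cinner (B x) x)"
  shows "\<exists>w. B w = v"
proof -
  note B_ops = selfadjoint_bounded_ops[OF B]
  have below: "1 * norm x \<le> norm (B x)" for x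
  proof (cases "x = 0")
    case False
    have "norm x * norm x \<le> norm (B x) * norm x"
      using coercive[of x] Re_cinner_le[of "B x" x] by (simp add: power2_eq_square)
    then show ?thesis using False by simp
  qed simp
  have "complete (range B)"
    by (rule complete_isometric_image[OF zero_less_one subspace_UNIV
          bounded_ops_bounded_linear[OF B_ops]]) (use below in \<open>auto simp: complete_UNIV\<close>)
  moreover have "complex_vector.subspace (range B)"
    unfolding complex_vector.subspace_def
    using B_ops by (auto simp: bounded_ops_simps[OF B_ops, symmetric] intro: range_eqI[of _ _ 0])
  ultimately have "closed_csubspace (range B)"
    by (simp add: complete_imp_closed)
  then obtain m where m: "m \<in> range B" "v - m \<in> ortho_compl (range B)"
    using closed_subspace_decomposition by blast
  have "cinner (B (v - m)) (v - m) = 0"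
    using m B by (auto simp: ortho_compl_def selfadjoint_cinner)
  then have "v = m"
    using coercive[of "v - m"] by simp
  then show ?thesis using m by blast
qed

text \<open>
  Let \<open>B\<^sub>n = 1 + A + \<dots> + A\<^sup>n\<close> and \<open>B\<^sub>n w\<^sub>n = v\<close>. All moments \<open>\<langle>A\<^sup>k w\<^sub>n, w\<^sub>n\<rangle>\<close> are nonnegative, so that
  expanding \<open>\<parallel>B\<^sub>n w\<^sub>n\<parallel>\<^sup>2\<close> gives \<open>\<parallel>A\<^sup>k w\<^sub>n\<parallel> \<le> \<parallel>v\<parallel>\<close> for \<open>k \<le> n\<close>, and \<open>(1 - A) B\<^sub>n = 1 - A\<^sup>n\<^sup>+\<^sup>1\<close> gives
  \<open>Re \<langle>w\<^sub>n, v\<rangle> \<ge> \<delta>\<close> for \<open>\<delta> = \<langle>v - A v, v\<rangle>\<close>. These estimates describe a nested sequence of bounded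
  closed convex sets. A common point \<open>u\<close> has a bounded orbit, so it is orthogonal to \<open>v\<close>, and
  \<open>\<delta> \<le> Re \<langle>u, v\<rangle> = 0\<close>. In terms of functional calculus, \<open>w\<^sub>n\<close> tends to \<open>(1 - A)\<^sub>+ v\<close>.
\<close>

lemma bounded_orbit_lower:
  fixes A :: "'a::chilbert_space \<Rightarrow> 'a"
  assumes A: "positive_op A" and v: "v \<in> ortho_compl (bounded_orbit A)"
  shows "(norm v)\<^sup>2 \<le> Re (cinner (A v) v)"
proof -
  have sa: "selfadjoint A"
    using A by (simp add: positive_op_def)
  note A_ops = selfadjoint_bounded_ops[OF sa]
  note An = funpow_bounded_ops[OF A_ops]
  define \<delta> where "\<delta> = (norm v)\<^sup>2 - Re (cinner (A v) v)"
  define C where "C n = {u. (\<forall>k\<le>n. norm ((A ^^ k) u) \<le> norm v) \<and> \<delta> \<le> Re (cinner u v)}" for n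
  have nonneg: "0 \<le> Re (cinner ((A ^^ i) w) ((A ^^ j) w))" for i j w
    unfolding funpow_moment[OF sa] by (rule funpow_positive[OF A])
  have "\<exists>w. w \<in> C n" for n
  proof -
    define B where "B w = (\<Sum>k\<le>n. (A ^^ k) w)" for w
    have sB: "selfadjoint B"
      unfolding selfadjoint_def
    proof (intro conjI allI)
      have "B \<in> bounded_ops"
      proof (rule bounded_opsI)
        show "B (x + y) = B x + B y" for x y
          by (simp add: B_def bounded_ops_add[OF An] sum.distrib)
        show "B (c *\<^sub>C x) = c *\<^sub>C B x" for c x
          by (simp add: B_def bounded_ops_scaleC[OF An] complex_vector.scale_sum_right)
        show "norm (B x) \<le> norm x * (\<Sum>k\<le>n. onorm (A ^^ k))" for x
          unfolding B_def sum_distrib_left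
          by (rule order_trans[OF norm_sum])
            (intro sum_mono, subst mult.commute, rule bounded_ops_norm_le[OF An])
      qed
      then show "B \<in> bounded_ops" .
      show "cinner (B x) y = cinner x (B y)" for x y
        by (simp add: B_def cinner_sum_left cinner_sum_right funpow_selfadjoint[OF sa])
    qed
    have "(norm x)\<^sup>2 \<le> Re (cinner (B x) x)" for x
    proof -
      have "(norm x)\<^sup>2 = Re (cinner ((A ^^ 0) x) x)"
        by (simp add: norm_sq_cinner)
      also have "\<dots> \<le> (\<Sum>k\<le>n. Re (cinner ((A ^^ k) x) x))"
        by (rule member_le_sum) (auto simp: funpow_positive[OF A] simp del: funpow.simps)
      finally show ?thesis
        by (simp add: B_def cinner_sum_left)
    qed
    from coercive_surj[OF sB this] obtain w where w: "B w = v" by blast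
    have "norm ((A ^^ k) w) \<le> norm v" if "k \<le> n" for k
    proof -
      have "(norm ((A ^^ k) w))\<^sup>2 = Re (cinner ((A ^^ k) w) ((A ^^ k) w))"
        by (simp add: norm_sq_cinner)
      also have "\<dots> \<le> (\<Sum>j\<le>n. Re (cinner ((A ^^ k) w) ((A ^^ j) w)))"
        using that nonneg by (intro member_le_sum[of k "{..n}" "\<lambda>j. Re (cinner ((A ^^ k) w) ((A ^^ j) w))"]) auto
      also have "\<dots> \<le> (\<Sum>i\<le>n. \<Sum>j\<le>n. Re (cinner ((A ^^ i) w) ((A ^^ j) w)))"
        using that nonneg
        by (intro member_le_sum[of k "{..n}" "\<lambda>i. \<Sum>j\<le>n. Re (cinner ((A ^^ i) w) ((A ^^ j) w))"])
          (auto intro: sum_nonneg)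
      also have "\<dots> = (norm v)\<^sup>2"
        unfolding w[symmetric] B_def norm_sq_cinner unfolding cinner_sum_left
        unfolding cinner_sum_right Re_sum ..
      finally show ?thesis
        by (rule power2_le_imp_le) simp
    qed
    moreover have "\<delta> \<le> Re (cinner w v)"
    proof -
      have "A v = (\<Sum>k\<le>n. (A ^^ Suc k) w)"
        unfolding w[symmetric] B_def
        by (subst linear_sum[OF bounded_linear.linear[OF bounded_ops_bounded_linear[OF A_ops]]])
          simp
      then have "v - A v = (\<Sum>k\<le>n. (A ^^ k) w - (A ^^ Suc k) w)"
        unfolding sum_subtractf w[symmetric] B_def by simp
      also have "\<dots> = w - (A ^^ Suc n) w"
        using sum_telescope[of "\<lambda>k. (A ^^ k) w" n] by simp
      finally have "Re (cinner (v - A v) v) = Re (cinner w v) - Re (cinner ((A ^^ Suc n) w) v)"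
        by (simp add: cinner_diff_left)
      moreover have "0 \<le> Re (cinner ((A ^^ Suc n) w) v)"
        unfolding w[symmetric] B_def cinner_sum_right Re_sum
        by (intro sum_nonneg nonneg)
      ultimately show ?thesis
        by (simp add: \<delta>_def cinner_diff_left norm_sq_cinner)
    qed
    ultimately show ?thesis
      unfolding C_def by blast
  qed
  then have ne: "\<exists>w\<in>C n. norm w \<le> norm v" for n
    unfolding C_def by (metis (mono_tags, lifting) funpow_0 le0 mem_Collect_eq)
  have "\<exists>u. \<forall>n. u \<in> C n"
  proof (rule nested_convex_Inter_nonempty[OF _ _ _ _ ne])
    show "C n \<noteq> {}" for n using ne by blast
    have "C n = (\<Inter>k\<in>{..n}. {u. norm ((A ^^ k) u) \<le> norm v}) \<inter> {u. \<delta> \<le> Re (cinner u v)}" for n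
      by (auto simp: C_def)
    then show "closed (C n)" for n
      using An by (auto intro!: closed_Int closed_INT closed_Collect_le continuous_intros
          continuous_on_bounded_ops bounded_ops_cinner)
    show "decseq C"
      unfolding decseq_def C_def by auto
    fix n x y assume x: "x \<in> C n" and y: "y \<in> C n"
    have "norm ((A ^^ k) ((1/2) *\<^sub>R (x + y))) \<le> norm v" if "k \<le> n" for k
    proof -
      have "norm ((A ^^ k) x) \<le> norm v" "norm ((A ^^ k) y) \<le> norm v"
        using x y that by (auto simp: C_def)
      then show ?thesis
        using norm_triangle_ineq[of "(A ^^ k) x" "(A ^^ k) y"]
        by (simp add: bounded_ops_scaleR[OF An] bounded_ops_add[OF An])
    qed
    moreover have "\<delta> \<le> Re (cinner ((1/2) *\<^sub>R (x + y)) v)"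
      using x y by (simp add: C_def cinner_scaleR_left cinner_add_left)
    ultimately show "(1/2) *\<^sub>R (x + y) \<in> C n"
      by (simp add: C_def)
  qed
  then obtain u where u: "\<And>n. u \<in> C n" by blast
  then have "u \<in> bounded_orbit A"
    unfolding bounded_orbit_def C_def by blast
  then have "cinner v u = 0"
    using v by (simp add: ortho_compl_def)
  then have "cinner u v = 0"
    using cinner_commute[of u v] by simp
  then show ?thesis
    using u[of 0] by (simp add: C_def \<delta>_def)
qed


text \<open>
  On an invariant subspace where \<open>0 \<le> Z \<le> r\<close>, the inequality \<open>Z\<^sup>2 \<le> r Z\<close> follows from
  \<open>r Z (r - Z) = Z (r - Z) Z + (r - Z) Z (r - Z)\<close>; hence \<open>\<parallel>Z u\<parallel>\<^sup>2 \<le> r \<langle>Z u, u\<rangle> \<le> r\<^sup>2 \<parallel>u\<parallel>\<^sup>2\<close>.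
\<close>

lemma norm_le_of_form_bounds:
  assumes Z: "selfadjoint Z" and G: "complex_vector.subspace G"
    and inv: "\<And>u. u \<in> G \<Longrightarrow> Z u \<in> G" and r: "0 < r"
    and bounds: "\<And>u. u \<in> G \<Longrightarrow> 0 \<le> Re (cinner (Z u) u)"
      "\<And>u. u \<in> G \<Longrightarrow> Re (cinner (Z u) u) \<le> r * (norm u)\<^sup>2"
    and u: "u \<in> G"
  shows "norm (Z u) \<le> r * norm u"
proof -
  note Z_ops = selfadjoint_bounded_ops[OF Z]
  define w where "w = r *\<^sub>R u - Z u"
  have "w \<in> G"
    unfolding w_def scaleR_scaleC using G u inv
    by (intro complex_vector.subspace_diff complex_vector.subspace_scale)
  have "0 \<le> r * (norm (Z u))\<^sup>2 - Re (cinner (Z (Z u)) (Z u)) + Re (cinner (Z w) w)"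
    using bounds(2)[OF inv[OF u]] bounds(1)[OF \<open>w \<in> G\<close>] by linarith
  also have "Re (cinner (Z w) w) =
      r * (r * Re (cinner (Z u) u)) - 2 * (r * (norm (Z u))\<^sup>2) + Re (cinner (Z (Z u)) (Z u))"
    using selfadjoint_cinner[OF Z, of "Z u" u]
    by (simp add: w_def bounded_ops_diff[OF Z_ops] bounded_ops_scaleR[OF Z_ops]
        cinner_linear_simps norm_sq_cinner algebra_simps)
  finally have "r * (norm (Z u))\<^sup>2 \<le> r * (r * Re (cinner (Z u) u))"
    by simp
  then have "(norm (Z u))\<^sup>2 \<le> r * Re (cinner (Z u) u)"
    using r by simp
  also have "\<dots> \<le> r * (r * (norm u)\<^sup>2)"
    using bounds(2)[OF u] r by simp
  also have "\<dots> = (r * norm u)\<^sup>2"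
    by (simp add: power2_eq_square)
  finally show ?thesis
    by (rule power2_le_imp_le) (use r in simp)
qed

text \<open>The spectral subspace of a positive operator for the interval \<open>[0, c]\<close>.\<close>

definition spectral_below :: "('a::complex_inner \<Rightarrow> 'a) \<Rightarrow> real \<Rightarrow> 'a set"
  where "spectral_below A c = bounded_orbit (\<lambda>x. (1 / c) *\<^sub>R A x)"

lemma positive_op_scaleR:
  assumes A: "positive_op A" and c: "0 \<le> c"
  shows "positive_op (\<lambda>x. c *\<^sub>R A x)"
  using A c bounded_ops_scale[of A "complex_of_real c"]
  by (auto simp: positive_op_def selfadjoint_def scaleR_scaleC[where 'a='a] cinner_scaleC_left
      cinner_scaleC_right)

context
  fixes A :: "'a::chilbert_space \<Rightarrow> 'a" and c :: real
  assumes A: "positive_op A" and c: "0 < c"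
begin

lemma closed_csubspace_spectral_below: "closed_csubspace (spectral_below A c)"
  unfolding spectral_below_def using positive_op_scaleR[OF A, of "1 / c"] c
  by (intro closed_csubspace_bounded_orbit) (simp add: positive_op_def)

lemma spectral_below_upper:
  assumes "u \<in> spectral_below A c"
  shows "Re (cinner (A u) u) \<le> c * (norm u)\<^sup>2"
  using positive_op_scaleR[OF A, of "1 / c"] c assms
    bounded_orbit_upper[of "\<lambda>x. (1 / c) *\<^sub>R A x" u]
  by (simp add: spectral_below_def positive_op_def cinner_scaleR_left field_simps)

lemma spectral_below_lower:
  assumes "v \<in> ortho_compl (spectral_below A c)"
  shows "c * (norm v)\<^sup>2 \<le> Re (cinner (A v) v)"
  using positive_op_scaleR[OF A, of "1 / c"] c assms
    bounded_orbit_lower[of "\<lambda>x. (1 / c) *\<^sub>R A x" v]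
  by (simp add: spectral_below_def cinner_scaleR_left field_simps)

end

lemma spectral_below_intertwine:
  assumes "S \<in> bounded_ops" "\<And>x. S (A x) = B (S x)" "u \<in> spectral_below A c"
  shows "S u \<in> spectral_below B c"
  using assms unfolding spectral_below_def
  by (intro bounded_orbit_intertwine[of S "\<lambda>x. (1 / c) *\<^sub>R A x"]) (simp_all add: bounded_ops_scaleR)

text \<open>Taking adjoints in \<open>S A = B S\<close> gives \<open>S\<^sup>* B = A S\<^sup>*\<close>, so \<open>S\<^sup>*\<close> maps the subspace of \<open>B\<close> into that of \<open>A\<close>.\<close>

lemma spectral_below_compl_intertwine:
  fixes S :: "'a::chilbert_space \<Rightarrow> 'b::chilbert_space"
  assumes S: "S \<in> bounded_ops" and SA: "\<And>x. S (A x) = B (S x)"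
    and A: "selfadjoint A" and B: "selfadjoint B"
    and u: "u \<in> ortho_compl (spectral_below A c)"
  shows "S u \<in> ortho_compl (spectral_below B c)"
proof (rule maps_ortho_compl[OF S _ u])
  fix y assume y: "y \<in> spectral_below B c"
  have "cadjoint S (B x) = A (cadjoint S x)" for x
    by (rule cinner_ext)
      (simp add: cadjoint'[OF S] selfadjoint_cinner[OF A] selfadjoint_cinner[OF B] SA)
  then show "cadjoint S y \<in> spectral_below A c"
    by (rule spectral_below_intertwine[OF cadjoint_bounded_ops[OF S] _ y])
qed


section \<open>From spectral subspaces to operators\<close>

text \<open>The spectral subspace of a positive operator for the interval \<open>(a, b]\<close>.\<close>

definition spectral_slice :: "('a::complex_inner \<Rightarrow> 'a) \<Rightarrow> real \<Rightarrow> real \<Rightarrow> 'a set"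
  where "spectral_slice A a b = spectral_below A b \<inter> ortho_compl (spectral_below A a)"

lemma spectral_slice_near:
  fixes Z :: "'a::chilbert_space \<Rightarrow> 'a"
  assumes Z: "positive_op Z" and ab: "0 < a" "a < b" and u: "u \<in> spectral_slice Z a b"
  shows "norm (Z u - a *\<^sub>R u) \<le> (b - a) * norm u"
proof (rule norm_le_of_form_bounds[of "\<lambda>u. Z u - a *\<^sub>R u" "spectral_slice Z a b"])
  have sZ: "selfadjoint Z" using Z by (simp add: positive_op_def)
  note Z_ops = selfadjoint_bounded_ops[OF sZ]
  show "selfadjoint (\<lambda>u. Z u - a *\<^sub>R u)"
    using sZ bounded_ops_minus[OF Z_ops bounded_ops_scale[OF bounded_ops_id, of "complex_of_real a"]]
    by (simp add: selfadjoint_def cinner_linear_simps scaleR_scaleC[where 'a='a])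
  have sub: "complex_vector.subspace (spectral_slice Z a b)"
    unfolding spectral_slice_def using ab closed_csubspace_ortho_compl
      closed_csubspace_spectral_below[OF Z, of b]
    by (intro complex_vector.subspace_inter) auto
  then show "complex_vector.subspace (spectral_slice Z a b)" .
  show "0 < b - a" using ab by auto
  show "u \<in> spectral_slice Z a b" by (rule u)
  fix u assume u: "u \<in> spectral_slice Z a b"
  then have "Z u \<in> spectral_slice Z a b"
    using spectral_below_intertwine[of Z Z Z, OF Z_ops refl]
      spectral_below_compl_intertwine[of Z Z Z, OF Z_ops refl sZ sZ]
    by (simp add: spectral_slice_def)
  then show "Z u - a *\<^sub>R u \<in> spectral_slice Z a b"
    using u sub unfolding scaleR_scaleC
    by (intro complex_vector.subspace_diff complex_vector.subspace_scale) auto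
  have "a * (norm u)\<^sup>2 \<le> Re (cinner (Z u) u)" "Re (cinner (Z u) u) \<le> b * (norm u)\<^sup>2"
    using u ab spectral_below_lower[OF Z, of a u] spectral_below_upper[OF Z, of b u]
    by (auto simp: spectral_slice_def)
  then show "0 \<le> Re (cinner (Z u - a *\<^sub>R u) u)"
    "Re (cinner (Z u - a *\<^sub>R u) u) \<le> (b - a) * (norm u)\<^sup>2"
    by (simp_all add: cinner_linear_simps norm_sq_cinner left_diff_distrib)
qed

text \<open>
  The operator \<open>D = T X - Y T\<close> respects the spectral subspaces as well. It is small on the
  subspace for a short interval \<open>(a, b]\<close>, since there \<open>X\<close> and \<open>Y\<close> are close to the scalar \<open>a\<close>.
  Splitting the interval halves this bound: the two halves of a vector have orthogonal images.
\<close>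

lemma intertwine_of_spectral_below:
  fixes T :: "'a::chilbert_space \<Rightarrow> 'b::chilbert_space"
  assumes T: "T \<in> bounded_ops" and X: "positive_op X" and Y: "positive_op Y"
    and lower: "\<And>u. (norm u)\<^sup>2 \<le> Re (cinner (X u) u)"
    and below: "\<And>c u. 0 < c \<Longrightarrow> u \<in> spectral_below X c \<Longrightarrow> T u \<in> spectral_below Y c"
    and above: "\<And>c u. 0 < c \<Longrightarrow> u \<in> ortho_compl (spectral_below X c)
      \<Longrightarrow> T u \<in> ortho_compl (spectral_below Y c)"
  shows "T (X u) = Y (T u)"
proof -
  have sX: "selfadjoint X" and sY: "selfadjoint Y"
    using X Y by (auto simp: positive_op_def)
  note X_ops = selfadjoint_bounded_ops[OF sX] and Y_ops = selfadjoint_bounded_ops[OF sY]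
  define D where "D x = T (X x) - Y (T x)" for x
  define E where "E c = proj_onto (spectral_below X c)" for c
  define F where "F c = proj_onto (spectral_below Y c)" for c
  have E: "E c \<in> projections" "range (E c) = spectral_below X c" if "0 < c" for c
    unfolding E_def using proj_onto[OF closed_csubspace_spectral_below[OF X that]] by auto
  have F: "F c \<in> projections" "range (F c) = spectral_below Y c" if "0 < c" for c
    unfolding F_def using proj_onto[OF closed_csubspace_spectral_below[OF Y that]] by auto
  have E_X: "X (E c x) = E c (X x)" if "0 < c" for c x
    by (rule proj_intertwine[OF E(1) E(1) X_ops], unfold E(2)[OF that])
      (use that spectral_below_intertwine[of X X X, OF X_ops refl]
        spectral_below_compl_intertwine[of X X X, OF X_ops refl sX sX] in auto)
  have F_Y: "Y (F c x) = F c (Y x)" if "0 < c" for c x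
    by (rule proj_intertwine[OF F(1) F(1) Y_ops], unfold F(2)[OF that])
      (use that spectral_below_intertwine[of Y Y Y, OF Y_ops refl]
        spectral_below_compl_intertwine[of Y Y Y, OF Y_ops refl sY sY] in auto)
  have T_E: "T (E c x) = F c (T x)" if "0 < c" for c x
    by (rule proj_intertwine[OF E(1) F(1) T], unfold E(2)[OF that] F(2)[OF that])
      (use that below above in auto)
  have D_E: "D (E c x) = F c (D x)" if "0 < c" for c x
    using that F[OF that]
    by (simp add: D_def E_X T_E F_Y bounded_ops_diff projections_bounded_ops)
  have D_add: "D (x + y) = D x + D y" for x y
    using T X_ops Y_ops by (simp add: D_def bounded_ops_add)

  have bisect: "norm (D u) \<le> 2 * onorm T * ((b - a) / 2 ^ n) * norm u"
    if "0 < a" "a < b" "u \<in> spectral_slice X a b" for n a b u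
    using that
  proof (induction n arbitrary: a b u)
    case 0
    then have "T u \<in> spectral_slice Y a b"
      using below above by (simp add: spectral_slice_def)
    have "D u = T (X u - a *\<^sub>R u) - (Y (T u) - a *\<^sub>R T u)"
      using T by (simp add: D_def bounded_ops_diff bounded_ops_scaleR)
    then have "norm (D u) \<le> norm (T (X u - a *\<^sub>R u)) + norm (Y (T u) - a *\<^sub>R T u)"
      using norm_triangle_ineq4 by metis
    also have "\<dots> \<le> onorm T * ((b - a) * norm u) + (b - a) * (onorm T * norm u)"
    proof (rule add_mono)
      show "norm (T (X u - a *\<^sub>R u)) \<le> onorm T * ((b - a) * norm u)"
        using bounded_ops_norm_le[OF T] spectral_slice_near[OF X 0]
          onorm_pos_le[OF bounded_ops_bounded_linear[OF T]]
        by (meson mult_left_mono order_trans)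
      show "norm (Y (T u) - a *\<^sub>R T u) \<le> (b - a) * (onorm T * norm u)"
        using spectral_slice_near[OF Y 0(1,2) \<open>T u \<in> spectral_slice Y a b\<close>] bounded_ops_norm_le[OF T, of u] 0(2)
          mult_left_mono[of "norm (T u)" "onorm T * norm u" "b - a"] by linarith
    qed
    finally show ?case by (simp add: algebra_simps)
  next
    case (Suc n)
    define c where "c = (a + b) / 2"
    have c: "0 < c" "a < c" "c < b"
      using Suc.prems by (auto simp: c_def)
    define k where "k = 2 * onorm T * ((b - a) / 2 ^ Suc n)"
    have k: "2 * onorm T * ((c - a) / 2 ^ n) = k" "2 * onorm T * ((b - c) / 2 ^ n) = k"
      by (simp_all add: k_def c_def field_simps)
    have k0: "0 \<le> k"
      using onorm_pos_le[OF bounded_ops_bounded_linear[OF T]] Suc.prems by (simp add: k_def)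
    define u1 where "u1 = E c u"
    define u2 where "u2 = u - u1"
    have u12: "u = u1 + u2" by (simp add: u2_def)
    have Ec_ops: "E c \<in> bounded_ops"
      using E[OF c(1)] projections_bounded_ops by blast
    have sEc: "selfadjoint (E c)"
      using E(1)[OF c(1)] Ec_ops by (simp add: selfadjoint_def projections_cinner)
    have u: "u \<in> spectral_below X b" "u \<in> ortho_compl (spectral_below X a)"
      using Suc.prems by (auto simp: spectral_slice_def)
    \<comment> \<open>\<open>E c\<close> commutes with \<open>X\<close>, so it respects all other spectral subspaces of \<open>X\<close>.\<close>
    have EX: "E c (X x) = X (E c x)" for x
      using E_X[OF c(1)] by simp
    have u1: "u1 \<in> spectral_below X c" "u1 \<in> spectral_below X b"
      "u1 \<in> ortho_compl (spectral_below X a)"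
      using E(2)[OF c(1)] spectral_below_intertwine[of "E c" X X, OF Ec_ops EX u(1)]
        spectral_below_compl_intertwine[of "E c" X X, OF Ec_ops EX sX sX u(2)]
      by (auto simp: u1_def)
    have u2: "u2 \<in> ortho_compl (spectral_below X c)"
      using E[OF c(1)] projections_idem[OF E(1)[OF c(1)]] Ec_ops
      by (simp add: u2_def u1_def ortho_compl_range_projection bounded_ops_diff
          flip: E(2)[OF c(1)])
    have u2b: "u2 \<in> spectral_below X b"
      unfolding u2_def using u(1) u1(2) closed_csubspace_spectral_below[OF X, of b] Suc.prems
      by (intro complex_vector.subspace_diff) auto
    have "norm (D u1) \<le> k * norm u1"
      using Suc.IH[of a c u1] u1 Suc.prems c unfolding k by (simp add: spectral_slice_def)
    moreover have "norm (D u2) \<le> k * norm u2"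
      using Suc.IH[of c b u2] u2 u2b Suc.prems c unfolding k by (simp add: spectral_slice_def)
    ultimately have "(norm (D u1))\<^sup>2 + (norm (D u2))\<^sup>2 \<le> (k * norm u1)\<^sup>2 + (k * norm u2)\<^sup>2"
      by (intro add_mono power_mono) auto
    also have "(norm (D u1))\<^sup>2 + (norm (D u2))\<^sup>2 = (norm (D u))\<^sup>2"
    proof -
      have Du1: "D u1 = F c (D u)"
        unfolding u1_def by (rule D_E[OF c(1)])
      have "D u1 + D u2 = D u"
        by (simp add: u12 D_add)
      then have "F c (D u2) = 0"
        using F[OF c(1)] Du1 projections_idem[OF F(1)[OF c(1)]]
          bounded_ops_add[OF projections_bounded_ops[OF F(1)[OF c(1)]]]
        by (metis add_cancel_right_right)
      then have "cinner (D u1) (D u2) = 0"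
        using F[OF c(1)] Du1 projections_cinner[OF F(1)[OF c(1)]] by simp
      from pythagoras[OF this] show ?thesis
        using \<open>D u1 + D u2 = D u\<close> by simp
    qed
    also have "(k * norm u1)\<^sup>2 + (k * norm u2)\<^sup>2 = (k * norm u)\<^sup>2"
    proof -
      have "cinner u2 u1 = 0"
        using u1 u2 by (simp add: ortho_compl_def)
      then have "cinner u1 u2 = 0"
        using cinner_commute[of u1 u2] by simp
      from pythagoras[OF this] show ?thesis
        using u12 by (simp add: power_mult_distrib flip: distrib_left)
    qed
    finally show ?case
      unfolding k_def[symmetric] by (rule power2_le_imp_le) (use k0 in simp)
  qed
  \<comment> \<open>The spectrum of \<open>X\<close> lies in \<open>[1, \<parallel>X\<parallel>]\<close>; the interval here contains it with a margin on both sides.\<close>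
  have whole: "u \<in> spectral_slice X (1/2) (onorm X + 1)"
  proof -
    have pos: "0 < onorm X + 1"
      using onorm_pos_le[OF bounded_ops_bounded_linear[OF X_ops]] by linarith
    have zero_half: "v = 0" if "v \<in> spectral_below X (1/2)" for v
    proof -
      have "(norm v)\<^sup>2 \<le> 1/2 * (norm v)\<^sup>2"
        using spectral_below_upper[OF X _ that] lower[of v] by linarith
      then have "(norm v)\<^sup>2 \<le> 0" by linarith
      then show ?thesis by simp
    qed
    then have "u \<in> ortho_compl (spectral_below X (1/2))"
      unfolding ortho_compl_def by (intro CollectI ballI) (drule zero_half, simp)
    moreover have zero: "v = 0" if "v \<in> ortho_compl (spectral_below X (onorm X + 1))" for v
    proof -
      have "Re (cinner (X v) v) \<le> onorm X * norm v * norm v"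
        using Re_cinner_le[of "X v" v] bounded_ops_norm_le[OF X_ops, of v]
          mult_right_mono[of "norm (X v)" "onorm X * norm v" "norm v"] by simp
      then have "(norm v)\<^sup>2 \<le> 0"
        using spectral_below_lower[OF X pos that] by (simp add: algebra_simps power2_eq_square)
      then show ?thesis by simp
    qed
    have "u \<in> ortho_compl (ortho_compl (spectral_below X (onorm X + 1)))"
      unfolding ortho_compl_def[of "ortho_compl _"]
      by (intro CollectI ballI) (drule zero, simp)
    ultimately show ?thesis
      unfolding spectral_slice_def
        ortho_compl_ortho_compl[OF closed_csubspace_spectral_below[OF X pos]] by blast
  qed
  have "norm (D u) \<le> 0"
  proof (rule LIMSEQ_le_const)
    let ?K = "2 * onorm T * norm u * (onorm X + 1 - 1/2)"
    have "(\<lambda>n. ?K * (1 / 2 ^ n)) \<longlonglongrightarrow> ?K * 0"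
      by (intro tendsto_intros LIMSEQ_divide_realpow_zero) simp
    then show "(\<lambda>n. ?K * (1 / 2 ^ n)) \<longlonglongrightarrow> 0" by simp
    have "norm (D u) \<le> ?K * (1 / 2 ^ n)" for n
    proof -
      have "norm (D u) \<le> 2 * onorm T * ((onorm X + 1 - 1/2) / 2 ^ n) * norm u"
        using onorm_pos_le[OF bounded_ops_bounded_linear[OF X_ops]]
        by (intro bisect whole) auto
      also have "\<dots> = ?K * (1 / 2 ^ n)"
        by (simp add: field_simps)
      finally show ?thesis .
    qed
    then show "\<exists>N. \<forall>n\<ge>N. norm (D u) \<le> ?K * (1 / 2 ^ n)" by blast
  qed
  then show ?thesis by (simp add: D_def)
qed

lemma Ref_bounded_ops: "T \<in> Ref \<U> \<Longrightarrow> T \<in> bounded_ops"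
  by (simp add: Ref_def)

lemma Ref_maps_closed:
  assumes "T \<in> Ref \<U>" "closed K" "\<And>S. S \<in> \<U> \<Longrightarrow> S x \<in> K"
  shows "T x \<in> K"
proof -
  have "closure {S x | S. S \<in> \<U>} \<subseteq> K"
    using assms by (intro closure_minimal) auto
  then show ?thesis
    using assms by (auto simp: Ref_def)
qed

text \<open>
  Adding the same large constant to \<open>X\<close> and \<open>Y\<close> makes them positive, with spectrum in \<open>[1, \<infinity>)\<close>. Then the elements of \<open>\<U>\<close>
  map the spectral subspaces of \<open>X\<close> into those of \<open>Y\<close>, and likewise their complements.
  Conditions of this kind pass to \<open>Ref \<U>\<close>.
\<close>

lemma Ref_intertwines_selfadjoint:
  fixes T :: "'a::chilbert_space \<Rightarrow> 'b::chilbert_space"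
  assumes U: "\<U> \<subseteq> bounded_ops" and T: "T \<in> Ref \<U>"
    and X: "selfadjoint X" and Y: "selfadjoint Y"
    and SX: "\<And>S x. S \<in> \<U> \<Longrightarrow> S (X x) = Y (S x)"
  shows "T (X u) = Y (T u)"
proof -
  note T_ops = Ref_bounded_ops[OF T]
  note X_ops = selfadjoint_bounded_ops[OF X] and Y_ops = selfadjoint_bounded_ops[OF Y]
  define k where "k = 1 + onorm X + onorm Y"
  have k: "1 + onorm X \<le> k" "1 + onorm Y \<le> k"
    using X_ops Y_ops by (auto simp: k_def onorm_pos_le bounded_ops_bounded_linear)
  have shift: "positive_op (\<lambda>x. Z x + k *\<^sub>R x)" "(norm v)\<^sup>2 \<le> Re (cinner (Z v + k *\<^sub>R v) v)"
    if Z: "selfadjoint Z" and kZ: "1 + onorm Z \<le> k" for Z :: "'c::chilbert_space \<Rightarrow> 'c" and v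
  proof -
    note Z_ops = selfadjoint_bounded_ops[OF Z]
    have ge: "(norm v)\<^sup>2 \<le> Re (cinner (Z v + k *\<^sub>R v) v)" for v
    proof -
      have "- Re (cinner (Z v) v) \<le> norm (Z v) * norm v"
        using Re_cinner_le[of "- Z v" v] by (simp add: cinner_minus_left)
      also have "\<dots> \<le> onorm Z * norm v * norm v"
        using bounded_ops_norm_le[OF Z_ops] by (intro mult_right_mono) auto
      finally have "(norm v)\<^sup>2 - onorm Z * (norm v)\<^sup>2 - (norm v)\<^sup>2 \<le> Re (cinner (Z v) v)"
        by (simp add: power2_eq_square mult.assoc)
      moreover have "(1 + onorm Z) * (norm v)\<^sup>2 \<le> k * (norm v)\<^sup>2"
        using kZ by (intro mult_right_mono) auto
      moreover have "Re (cinner (Z v + k *\<^sub>R v) v) = Re (cinner (Z v) v) + k * (norm v)\<^sup>2"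
        by (simp add: cinner_linear_simps norm_sq_cinner)
      ultimately show ?thesis
        by (simp add: distrib_right)
    qed
    show "(norm v)\<^sup>2 \<le> Re (cinner (Z v + k *\<^sub>R v) v)" by (rule ge)
    have "0 \<le> Re (cinner (Z v + k *\<^sub>R v) v)" for v
      using ge[of v] zero_le_power2[of "norm v"] by linarith
    then show "positive_op (\<lambda>x. Z x + k *\<^sub>R x)"
      using Z bounded_ops_plus[OF Z_ops bounded_ops_scale[OF bounded_ops_id, of "complex_of_real k"]]
      by (simp add: positive_op_def selfadjoint_def cinner_linear_simps scaleR_scaleC[where 'a='c])
  qed
  define X' where "X' x = X x + k *\<^sub>R x" for x
  define Y' where "Y' x = Y x + k *\<^sub>R x" for x
  have X': "positive_op X'" "\<And>v. (norm v)\<^sup>2 \<le> Re (cinner (X' v) v)"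
    unfolding X'_def by (rule shift[OF X k(1)])+
  have Y': "positive_op Y'"
    unfolding Y'_def by (rule shift[OF Y k(2)])
  have SX': "S (X' x) = Y' (S x)" if "S \<in> \<U>" for S x
    using that U SX by (auto simp: X'_def Y'_def bounded_ops_add bounded_ops_scaleR)
  have "T (X' u) = Y' (T u)"
  proof (rule intertwine_of_spectral_below[OF T_ops X'(1) Y' X'(2)])
    fix c :: real and u :: 'a
    assume c: "0 < c"
    show "T u \<in> spectral_below Y' c" if "u \<in> spectral_below X' c"
      using T
    proof (rule Ref_maps_closed)
      show "closed (spectral_below Y' c)"
        using closed_csubspace_spectral_below[OF Y' c] by blast
      show "S u \<in> spectral_below Y' c" if S: "S \<in> \<U>" for S
        by (rule spectral_below_intertwine[of S X' Y', OF _ SX'[OF S] \<open>u \<in> spectral_below X' c\<close>])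
          (use S U in auto)
    qed
    show "T u \<in> ortho_compl (spectral_below Y' c)" if "u \<in> ortho_compl (spectral_below X' c)"
      using T
    proof (rule Ref_maps_closed)
      show "closed (ortho_compl (spectral_below Y' c))"
        using closed_csubspace_ortho_compl by blast
      show "S u \<in> ortho_compl (spectral_below Y' c)" if S: "S \<in> \<U>" for S
        by (rule spectral_below_compl_intertwine[of S X' Y', OF _ SX'[OF S] _ _
              \<open>u \<in> ortho_compl (spectral_below X' c)\<close>])
          (use S U X' Y' in \<open>auto simp: positive_op_def\<close>)
    qed
  qed
  then show ?thesis
    using T_ops by (simp add: X'_def Y'_def bounded_ops_add bounded_ops_scaleR)
qed

text \<open>
  The self-adjoint operators \<open>p + p\<^sup>*\<close> and \<open>\<i>(p - p\<^sup>*)\<close> determine \<open>p\<close>, and likewise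
  for \<open>q\<close>.
\<close>

lemma Ref_intertwines:
  fixes T :: "'a::chilbert_space \<Rightarrow> 'b::chilbert_space"
  assumes U: "\<U> \<subseteq> bounded_ops" and T: "T \<in> Ref \<U>"
    and ops: "p \<in> bounded_ops" "p' \<in> bounded_ops" "q \<in> bounded_ops" "q' \<in> bounded_ops"
    and adj: "\<And>x y. cinner (p x) y = cinner x (p' y)" "\<And>x y. cinner (q x) y = cinner x (q' y)"
    and S: "\<And>S x. S \<in> \<U> \<Longrightarrow> S (p x) = q (S x)" "\<And>S x. S \<in> \<U> \<Longrightarrow> S (p' x) = q' (S x)"
  shows "T (p u) = q (T u)"
proof -
  note T_ops = Ref_bounded_ops[OF T]
  have adj': "cinner (p' x) y = cinner x (p y)" "cinner (q' z) w = cinner z (q w)" for x y z w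
    using adj(1)[of y x] adj(2)[of w z] by (metis cinner_commute)+
  have S_ops: "R \<in> bounded_ops" if "R \<in> \<U>" for R
    using that U by blast
  have 1: "T (p u + p' u) = q (T u) + q' (T u)"
    by (rule Ref_intertwines_selfadjoint[OF U T, of "\<lambda>x. p x + p' x" "\<lambda>x. q x + q' x"])
      (auto simp: selfadjoint_def bounded_ops_plus ops cinner_linear_simps adj adj'
        bounded_ops_add S_ops S)
  have 2: "T (\<i> *\<^sub>C (p u - p' u)) = \<i> *\<^sub>C (q (T u) - q' (T u))"
    by (rule Ref_intertwines_selfadjoint[OF U T, of "\<lambda>x. \<i> *\<^sub>C (p x - p' x)" "\<lambda>x. \<i> *\<^sub>C (q x - q' x)"])
      (auto simp: selfadjoint_def bounded_ops_minus bounded_ops_scale ops cinner_linear_simps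
        adj adj' bounded_ops_diff bounded_ops_scaleC S_ops S algebra_simps)
  have "\<i> *\<^sub>C T (p u - p' u) = \<i> *\<^sub>C (q (T u) - q' (T u))"
    using 2 T_ops by (simp add: bounded_ops_scaleC)
  then have "T (p u - p' u) = q (T u) - q' (T u)"
    by (simp add: complex_vector.scale_left_imp_eq)
  then have diff: "T (p u) - T (p' u) = q (T u) - q' (T u)"
    using T_ops by (simp add: bounded_ops_diff)
  have sum: "T (p u) + T (p' u) = q (T u) + q' (T u)"
    using 1 T_ops by (simp add: bounded_ops_add)
  have "2 *\<^sub>R T (p u) = (T (p u) + T (p' u)) + (T (p u) - T (p' u))"
    by (simp add: scaleR_2)
  also have "\<dots> = 2 *\<^sub>R q (T u)"
    unfolding sum diff by (simp add: scaleR_2)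
  finally have "2 *\<^sub>R T (p u) = 2 *\<^sub>R q (T u)" .
  then show ?thesis by simp
qed


section \<open>Square-summable sequences\<close>

lemma summable_norm_sq_add:
  fixes x y :: "nat \<Rightarrow> 'a::complex_inner"
  assumes "summable (\<lambda>n. (norm (x n))\<^sup>2)" "summable (\<lambda>n. (norm (y n))\<^sup>2)"
  shows "summable (\<lambda>n. (norm (x n + y n))\<^sup>2)"
proof (rule summable_comparison_test')
  show "summable (\<lambda>n. 2 * (norm (x n))\<^sup>2 + 2 * (norm (y n))\<^sup>2)"
    by (intro summable_add summable_mult assms)
  show "norm ((norm (x n + y n))\<^sup>2) \<le> 2 * (norm (x n))\<^sup>2 + 2 * (norm (y n))\<^sup>2" for n
    using parallelogram[of "x n" "y n"] zero_le_power2[of "norm (x n - y n)"]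
    unfolding real_norm_def abs_power2 abs_norm_cancel by linarith
qed

text \<open>
  The Hilbert space sum of countably many copies of the given space. Each functional
  \<open>T \<mapsto> \<Sum>n. \<langle>T x\<^sub>n, y\<^sub>n\<rangle>\<close> that enters the ultraweak topology is a matrix coefficient of the operator
  on this space that applies \<open>T\<close> to every coordinate.
\<close>

typedef (overloaded) 'a l2 = "{x :: nat \<Rightarrow> 'a::complex_inner. summable (\<lambda>n. (norm (x n))\<^sup>2)}"
  morphisms l2_nth Abs_l2
  by (rule exI[of _ "\<lambda>_. 0"]) simp

setup_lifting type_definition_l2

lemma l2_eqI: "(\<And>n. l2_nth x n = l2_nth y n) \<Longrightarrow> x = y"
  using l2_nth_inject by blast

lemma summable_l2: "summable (\<lambda>n. (norm (l2_nth x n))\<^sup>2)"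
  using l2_nth by blast

instantiation l2 :: (complex_inner) complex_inner
begin

lift_definition zero_l2 :: "'a l2" is "\<lambda>_. 0" by simp

lift_definition plus_l2 :: "'a l2 \<Rightarrow> 'a l2 \<Rightarrow> 'a l2" is "\<lambda>x y n. x n + y n"
  by (rule summable_norm_sq_add)

lift_definition uminus_l2 :: "'a l2 \<Rightarrow> 'a l2" is "\<lambda>x n. - x n" by simp

lift_definition minus_l2 :: "'a l2 \<Rightarrow> 'a l2 \<Rightarrow> 'a l2" is "\<lambda>x y n. x n - y n"
  subgoal for x y using summable_norm_sq_add[of x "\<lambda>n. - y n"] by simp
  done

lift_definition scaleR_l2 :: "real \<Rightarrow> 'a l2 \<Rightarrow> 'a l2" is "\<lambda>r x n. r *\<^sub>R x n"
  by (simp add: power_mult_distrib summable_mult)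

lift_definition scaleC_l2 :: "complex \<Rightarrow> 'a l2 \<Rightarrow> 'a l2" is "\<lambda>c x n. c *\<^sub>C x n"
  by (simp add: norm_scaleC power_mult_distrib summable_mult)

definition cinner_l2 :: "'a l2 \<Rightarrow> 'a l2 \<Rightarrow> complex"
  where "cinner_l2 x y = (\<Sum>n. cinner (l2_nth x n) (l2_nth y n))"

definition norm_l2 :: "'a l2 \<Rightarrow> real"
  where "norm_l2 x = sqrt (\<Sum>n. (norm (l2_nth x n))\<^sup>2)"

definition dist_l2 :: "'a l2 \<Rightarrow> 'a l2 \<Rightarrow> real"
  where "dist_l2 x y = norm (x - y)"

definition sgn_l2 :: "'a l2 \<Rightarrow> 'a l2"
  where "sgn_l2 x = inverse (norm x) *\<^sub>R x"

definition uniformity_l2 :: "('a l2 \<times> 'a l2) filter"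
  where "uniformity_l2 = (INF e\<in>{0<..}. principal {(x, y). dist x y < e})"

definition open_l2 :: "'a l2 set \<Rightarrow> bool"
  where "open_l2 U \<longleftrightarrow> (\<forall>x\<in>U. eventually (\<lambda>(x', y). x' = x \<longrightarrow> y \<in> U) uniformity)"

lemma summable_cinner_l2:
  "summable (\<lambda>n. cinner (l2_nth x n) (l2_nth y n))" for x y :: "'a l2"
proof (rule summable_comparison_test')
  show "summable (\<lambda>n. (norm (l2_nth x n))\<^sup>2 + (norm (l2_nth y n))\<^sup>2)"
    by (intro summable_add summable_l2)
  show "norm (cinner (l2_nth x n) (l2_nth y n)) \<le> (norm (l2_nth x n))\<^sup>2 + (norm (l2_nth y n))\<^sup>2"
    for n
    using cauchy_schwarz[of "l2_nth x n" "l2_nth y n"]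
      sum_squares_bound[of "norm (l2_nth x n)" "norm (l2_nth y n)"]
      mult_nonneg_nonneg[of "norm (l2_nth x n)" "norm (l2_nth y n)"]
      norm_ge_zero[of "l2_nth x n"] norm_ge_zero[of "l2_nth y n"]
    by linarith
qed

lemma sum_le_norm_l2:
  "(\<Sum>n<N. (norm (l2_nth x n))\<^sup>2) \<le> (norm x)\<^sup>2" for x :: "'a l2"
  using sum_le_suminf[OF summable_l2[of x], of "{..<N}"] suminf_nonneg[OF summable_l2[of x]]
  by (simp add: norm_l2_def)

instance
proof
  fix x y z :: "'a l2" and r s :: real and c d :: complex
  show "x + y + z = x + (y + z)" by transfer (simp add: add.assoc)
  show "x + y = y + x" by transfer (simp add: add.commute)
  show "0 + x = x" by transfer simp
  show "- x + x = 0" by transfer simp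
  show "x - y = x + - y" by transfer simp
  show "r *\<^sub>R (x + y) = r *\<^sub>R x + r *\<^sub>R y" by transfer (simp add: scaleR_add_right)
  show "(r + s) *\<^sub>R x = r *\<^sub>R x + s *\<^sub>R x" by transfer (simp add: scaleR_add_left)
  show "r *\<^sub>R s *\<^sub>R x = (r * s) *\<^sub>R x" by transfer simp
  show "1 *\<^sub>R x = x" by transfer simp
  show "dist x y = norm (x - y)" by (rule dist_l2_def)
  show "sgn x = inverse (norm x) *\<^sub>R x" by (rule sgn_l2_def)
  show "uniformity = (INF e\<in>{0<..}. principal {(x, y :: 'a l2). dist x y < e})"
    by (rule uniformity_l2_def)
  show "open U = (\<forall>x\<in>U. eventually (\<lambda>(x', y). x' = x \<longrightarrow> y \<in> U) uniformity)" for U :: "'a l2 set"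
    by (rule open_l2_def)
  have nonneg: "0 \<le> norm x" for x :: "'a l2"
    by (simp add: norm_l2_def suminf_nonneg summable_l2)
  show "norm x = 0 \<longleftrightarrow> x = 0"
  proof -
    have "norm x = 0 \<longleftrightarrow> (\<forall>n. l2_nth x n = 0)"
      using suminf_eq_zero_iff[OF summable_l2[of x]] by (simp add: norm_l2_def)
    then show ?thesis
      by (auto simp: zero_l2.rep_eq intro!: l2_eqI)
  qed
  show "norm (x + y) \<le> norm x + norm y"
  proof -
    have "(\<Sum>n<N. (norm (l2_nth (x + y) n))\<^sup>2) \<le> (norm x + norm y)\<^sup>2" for N
    proof -
      have bound: "L2_set (\<lambda>n. norm (l2_nth z n)) {..<N} \<le> norm z" for z :: "'a l2"
        using sum_le_norm_l2[of z N] nonneg[of z] by (simp add: L2_set_def real_le_lsqrt)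
      have "L2_set (\<lambda>n. norm (l2_nth (x + y) n)) {..<N}
          \<le> L2_set (\<lambda>n. norm (l2_nth x n) + norm (l2_nth y n)) {..<N}"
        by (rule L2_set_mono) (auto simp: plus_l2.rep_eq norm_triangle_ineq)
      also have "\<dots> \<le> L2_set (\<lambda>n. norm (l2_nth x n)) {..<N} + L2_set (\<lambda>n. norm (l2_nth y n)) {..<N}"
        by (rule L2_set_triangle_ineq)
      also have "\<dots> \<le> norm x + norm y"
        by (intro add_mono bound)
      finally show ?thesis
        unfolding L2_set_def by (rule sqrt_le_D)
    qed
    then have "(\<Sum>n. (norm (l2_nth (x + y) n))\<^sup>2) \<le> (norm x + norm y)\<^sup>2"
      by (intro suminf_le_const summable_l2)
    then show ?thesis
      unfolding norm_l2_def[of "x + y"] using nonneg[of x] nonneg[of y]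
      by (intro real_le_lsqrt) auto
  qed
  show "norm (r *\<^sub>R x) = \<bar>r\<bar> * norm x"
    by (simp add: norm_l2_def scaleR_l2.rep_eq power_mult_distrib suminf_mult[OF summable_l2]
        real_sqrt_mult)
  show "c *\<^sub>C (x + y) = c *\<^sub>C x + c *\<^sub>C y" by transfer (simp add: scaleC_add_right)
  show "(c + d) *\<^sub>C x = c *\<^sub>C x + d *\<^sub>C x" by transfer (simp add: scaleC_add_left)
  show "c *\<^sub>C d *\<^sub>C x = (c * d) *\<^sub>C x" by transfer (simp add: scaleC_scaleC)
  show "1 *\<^sub>C x = x" by transfer (simp add: scaleC_one)
  show "r *\<^sub>R x = complex_of_real r *\<^sub>C x" by transfer (simp add: scaleR_scaleC)
  have "cnj (cinner y x) = (\<Sum>n. cnj (cinner (l2_nth y n) (l2_nth x n)))"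
    unfolding cinner_l2_def
    using sums_cnj[of "\<lambda>n. cinner (l2_nth y n) (l2_nth x n)"] summable_cinner_l2[of y x]
    by (metis sums_unique summable_sums)
  also have "\<dots> = cinner x y"
    unfolding cinner_l2_def by (subst cinner_commute) (rule refl)
  finally show "cinner x y = cnj (cinner y x)" by simp
  show "cinner (x + y) z = cinner x z + cinner y z"
    by (simp add: cinner_l2_def plus_l2.rep_eq cinner_add_left suminf_add[OF summable_cinner_l2 summable_cinner_l2])
  show "cinner (c *\<^sub>C x) y = c * cinner x y"
    by (simp add: cinner_l2_def scaleC_l2.rep_eq cinner_scaleC_left suminf_mult[OF summable_cinner_l2])
  have self: "cinner x x = complex_of_real ((norm x)\<^sup>2)"
  proof -
    have "cinner x x = complex_of_real (\<Sum>n. (norm (l2_nth x n))\<^sup>2)"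
      unfolding cinner_l2_def cinner_self by (rule suminf_of_real[OF summable_l2, symmetric])
    then show ?thesis
      by (simp add: norm_l2_def suminf_nonneg summable_l2)
  qed
  show "0 \<le> Re (cinner x x)"
    by (simp add: self)
  show "cinner x x = 0 \<longleftrightarrow> x = 0"
    using \<open>norm x = 0 \<longleftrightarrow> x = 0\<close> by (simp add: self)
  show "norm x = sqrt (Re (cinner x x))"
    using nonneg[of x] by (simp add: self)
qed

end

lemma norm_sq_l2: "(norm x)\<^sup>2 = (\<Sum>n. (norm (l2_nth x n))\<^sup>2)"
  by (simp add: norm_l2_def suminf_nonneg summable_l2)

lemma norm_l2_nth_le: "norm (l2_nth x n) \<le> norm x"
proof (rule power2_le_imp_le)
  have "(norm (l2_nth x n))\<^sup>2 \<le> (\<Sum>k<Suc n. (norm (l2_nth x k))\<^sup>2)"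
    by (rule member_le_sum) auto
  also have "\<dots> \<le> (norm x)\<^sup>2"
    by (rule sum_le_norm_l2)
  finally show "(norm (l2_nth x n))\<^sup>2 \<le> (norm x)\<^sup>2" .
qed simp

lemma norm_l2_leI:
  assumes "0 \<le> e" "\<And>N. (\<Sum>n<N. (norm (l2_nth x n))\<^sup>2) \<le> e\<^sup>2"
  shows "norm x \<le> e"
proof (rule power2_le_imp_le)
  show "(norm x)\<^sup>2 \<le> e\<^sup>2"
    unfolding norm_sq_l2 using assms(2) by (intro suminf_le_const summable_l2)
qed (rule assms)

lemma bounded_ops_l2_nth: "(\<lambda>x. l2_nth x n) \<in> bounded_ops"
  by (rule bounded_opsI[where K = 1]) (auto simp: plus_l2.rep_eq scaleC_l2.rep_eq norm_l2_nth_le)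

instance l2 :: (chilbert_space) chilbert_space
proof
  fix X :: "nat \<Rightarrow> 'a l2"
  assume X: "Cauchy X"
  have "Cauchy (\<lambda>k. l2_nth (X k) n)" for n
    using bounded_linear.Cauchy[OF bounded_ops_bounded_linear[OF bounded_ops_l2_nth] X] .
  then have "\<forall>n. \<exists>l. (\<lambda>k. l2_nth (X k) n) \<longlonglongrightarrow> l"
    by (simp add: Cauchy_convergent_iff convergent_def)
  then obtain f where f: "\<And>n. (\<lambda>k. l2_nth (X k) n) \<longlonglongrightarrow> f n"
    by metis
  \<comment> \<open>Only finite partial sums pass to the limit in the second index.\<close>
  have tail: "(\<Sum>n<N. (norm (l2_nth (X k) n - f n))\<^sup>2) \<le> e\<^sup>2"
    if K: "\<forall>k\<ge>K. \<forall>m\<ge>K. norm (X k - X m) < e" "K \<le> k" for K k N e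
  proof (rule LIMSEQ_le_const2)
    show "(\<lambda>m. \<Sum>n<N. (norm (l2_nth (X k) n - l2_nth (X m) n))\<^sup>2)
        \<longlonglongrightarrow> (\<Sum>n<N. (norm (l2_nth (X k) n - f n))\<^sup>2)"
      by (intro tendsto_intros f)
    have "(\<Sum>n<N. (norm (l2_nth (X k) n - l2_nth (X m) n))\<^sup>2) \<le> e\<^sup>2" if "K \<le> m" for m
    proof -
      have "(\<Sum>n<N. (norm (l2_nth (X k) n - l2_nth (X m) n))\<^sup>2) \<le> (norm (X k - X m))\<^sup>2"
        using sum_le_norm_l2[of "X k - X m" N] by (simp add: minus_l2.rep_eq)
      also have "\<dots> \<le> e\<^sup>2"
        using K that by (intro power_mono) (auto intro: less_imp_le)
      finally show ?thesis .
    qed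
    then show "\<exists>M. \<forall>m\<ge>M. (\<Sum>n<N. (norm (l2_nth (X k) n - l2_nth (X m) n))\<^sup>2) \<le> e\<^sup>2" by blast
  qed
  obtain K where K: "\<forall>k\<ge>K. \<forall>m\<ge>K. norm (X k - X m) < 1"
    using CauchyD[OF X, of 1] by auto
  have "summable (\<lambda>n. (norm (l2_nth (X K) n - f n))\<^sup>2)"
    by (rule summableI_nonneg_bounded[of _ "1\<^sup>2"]) (use tail[OF K order_refl] in auto)
  then have "summable (\<lambda>n. (norm (f n - l2_nth (X K) n))\<^sup>2)"
    by (simp add: norm_minus_commute)
  from summable_norm_sq_add[OF this summable_l2[of "X K"]]
  have "summable (\<lambda>n. (norm (f n))\<^sup>2)" by simp
  then have nth: "l2_nth (Abs_l2 f) = f"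
    by (simp add: Abs_l2_inverse)
  have "X \<longlonglongrightarrow> Abs_l2 f"
  proof (rule LIMSEQ_I)
    fix e :: real assume e: "0 < e"
    then obtain K where K: "\<forall>k\<ge>K. \<forall>m\<ge>K. norm (X k - X m) < e / 2"
      using CauchyD[OF X, of "e / 2"] by auto
    have "norm (X k - Abs_l2 f) \<le> e / 2" if "K \<le> k" for k
      by (rule norm_l2_leI) (use e tail[OF K that] in \<open>auto simp: minus_l2.rep_eq nth\<close>)
    then show "\<exists>K. \<forall>k\<ge>K. norm (X k - Abs_l2 f) < e"
      using e by (intro exI[of _ K]) force
  qed
  then show "convergent X"
    by (auto simp: convergent_def)
qed


section \<open>Amplifications\<close>

definition amplify :: "('a::complex_inner \<Rightarrow> 'b::complex_inner) \<Rightarrow> 'a l2 \<Rightarrow> 'b l2"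
  where "amplify T x = Abs_l2 (\<lambda>n. T (l2_nth x n))"

lift_definition l2_single :: "nat \<Rightarrow> 'a::complex_inner \<Rightarrow> 'a l2" is "\<lambda>n u m. if m = n then u else 0"
  by (rule summable_finite[of "{_}"]) auto

lemma l2_nth_amplify:
  assumes T: "T \<in> bounded_ops"
  shows "l2_nth (amplify T x) n = T (l2_nth x n)"
proof -
  have "summable (\<lambda>n. (norm (T (l2_nth x n)))\<^sup>2)"
  proof (rule summable_comparison_test')
    show "summable (\<lambda>n. (onorm T)\<^sup>2 * (norm (l2_nth x n))\<^sup>2)"
      by (intro summable_mult summable_l2)
    show "norm ((norm (T (l2_nth x n)))\<^sup>2) \<le> (onorm T)\<^sup>2 * (norm (l2_nth x n))\<^sup>2" for n
      using power_mono[OF bounded_ops_norm_le[OF T, of "l2_nth x n"], of 2]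
      by (simp add: power_mult_distrib)
  qed
  then show ?thesis
    by (simp add: amplify_def Abs_l2_inverse)
qed

lemma amplify_bounded_ops:
  assumes T: "T \<in> bounded_ops"
  shows "amplify T \<in> bounded_ops"
proof (rule bounded_opsI)
  show "amplify T (x + y) = amplify T x + amplify T y" for x y
    by (rule l2_eqI) (simp add: l2_nth_amplify[OF T] plus_l2.rep_eq bounded_ops_add[OF T])
  show "amplify T (c *\<^sub>C x) = c *\<^sub>C amplify T x" for c x
    by (rule l2_eqI) (simp add: l2_nth_amplify[OF T] scaleC_l2.rep_eq bounded_ops_scaleC[OF T])
  show "norm (amplify T x) \<le> norm x * onorm T" for x
  proof (rule norm_l2_leI)
    show "0 \<le> norm x * onorm T"
      using onorm_pos_le[OF bounded_ops_bounded_linear[OF T]] by simp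
    fix N
    have "(\<Sum>n<N. (norm (l2_nth (amplify T x) n))\<^sup>2) \<le> (\<Sum>n<N. (onorm T)\<^sup>2 * (norm (l2_nth x n))\<^sup>2)"
      using power_mono[OF bounded_ops_norm_le[OF T], of _ 2]
      by (intro sum_mono) (simp add: l2_nth_amplify[OF T] power_mult_distrib)
    also have "\<dots> \<le> (onorm T)\<^sup>2 * (norm x)\<^sup>2"
      unfolding sum_distrib_left[symmetric] by (intro mult_left_mono sum_le_norm_l2) simp
    finally show "(\<Sum>n<N. (norm (l2_nth (amplify T x) n))\<^sup>2) \<le> (norm x * onorm T)\<^sup>2"
      by (simp add: power_mult_distrib mult.commute)
  qed
qed

lemma cinner_amplify:
  fixes T :: "'a::chilbert_space \<Rightarrow> 'b::chilbert_space"
  assumes T: "T \<in> bounded_ops"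
  shows "cinner (amplify T x) y = cinner x (amplify (cadjoint T) y)"
  by (simp add: cinner_l2_def l2_nth_amplify[OF T] l2_nth_amplify[OF cadjoint_bounded_ops[OF T]]
      cadjoint[OF T])

lemma cadjoint_amplify:
  fixes T :: "'a::chilbert_space \<Rightarrow> 'b::chilbert_space"
  assumes T: "T \<in> bounded_ops"
  shows "cadjoint (amplify T) = amplify (cadjoint T)"
proof (rule ext, rule cinner_ext)
  fix y x
  show "cinner (cadjoint (amplify T) y) x = cinner (amplify (cadjoint T) y) x"
    unfolding cadjoint'[OF amplify_bounded_ops[OF T]]
    by (rule cinner_flip, rule cinner_amplify[OF T])
qed

lemma amplify_comp:
  assumes "S \<in> bounded_ops" "T \<in> bounded_ops"
  shows "amplify (S \<circ> T) x = amplify S (amplify T x)"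
  by (rule l2_eqI) (simp add: l2_nth_amplify assms bounded_ops_comp)

lemma cinner_l2_single: "cinner x (l2_single n u) = cinner (l2_nth x n) u"
proof -
  have "(\<lambda>m. cinner (l2_nth x m) (l2_nth (l2_single n u) m))
      = (\<lambda>m. if m = n then cinner (l2_nth x n) u else 0)"
    by (auto simp: l2_single.rep_eq)
  then show ?thesis
    unfolding cinner_l2_def using sums_single[of n "\<lambda>m. cinner (l2_nth x n) u"]
    by (simp add: sums_iff)
qed

lemma cinner_l2_single_left: "cinner (l2_single n u) x = cinner u (l2_nth x n)"
  by (rule cinner_flip, rule cinner_l2_single)

lemma bounded_ops_l2_single: "l2_single n \<in> bounded_ops"
proof (rule bounded_opsI[where K = 1])
  show "l2_single n (x + y) = l2_single n x + l2_single n y" for x y :: 'a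
    by transfer auto
  show "l2_single n (c *\<^sub>C x) = c *\<^sub>C l2_single n x" for c and x :: 'a
    by transfer auto
  show "norm (l2_single n x) \<le> norm x * 1" for x :: 'a
    by (simp add: norm_eq_sqrt_cinner[of "l2_single n x"] cinner_l2_single l2_single.rep_eq
        norm_eq_sqrt_cinner[of x])
qed

lemma amplify_l2_single:
  assumes "T \<in> bounded_ops"
  shows "amplify T (l2_single n u) = l2_single n (T u)"
  by (rule l2_eqI) (use assms in \<open>simp add: l2_nth_amplify l2_single.rep_eq\<close>)

text \<open>
  An operator is determined by its adjoint, whose values have as coordinates the inner products
  with the values of the operator on sequences supported at one index.
\<close>

lemma bounded_ops_eq_on_l2_single:
  fixes V W :: "'a::chilbert_space l2 \<Rightarrow> 'b::chilbert_space"
  assumes V: "V \<in> bounded_ops" and W: "W \<in> bounded_ops"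
    and eq: "\<And>n u. V (l2_single n u) = W (l2_single n u)"
  shows "V x = W x"
proof -
  have "cadjoint V y = cadjoint W y" for y
  proof (rule l2_eqI, rule cinner_ext)
    show "cinner (l2_nth (cadjoint V y) n) u = cinner (l2_nth (cadjoint W y) n) u" for n u
      by (simp add: cadjoint'[OF V] cadjoint'[OF W] eq flip: cinner_l2_single)
  qed
  then have "cinner (V x) y = cinner (W x) y" for y
    by (simp add: cadjoint[OF V] cadjoint[OF W])
  then show ?thesis by (rule cinner_ext)
qed


text \<open>
  Let \<open>K\<close> be the closure of \<open>\<U>\<^sup>\<infinity> x\<close> in \<open>\<ell>\<^sup>2\<close> and \<open>M\<close> the subspace of all \<open>z\<close> with \<open>\<U>\<^sup>\<infinity> z \<subseteq> K\<close>, so that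
  \<open>x \<in> M\<close>. Since \<open>R S\<^sup>* C \<in> \<U>\<close> for \<open>R, S, C \<in> \<U>\<close>, the adjoint of \<open>S\<^sup>\<infinity>\<close> maps \<open>K\<close> into \<open>M\<close>, and so \<open>S\<^sup>\<infinity>\<close>
  intertwines the projections \<open>P\<close> onto \<open>M\<close> and \<open>Q\<close> onto \<open>K\<close>. In terms of matrix entries,
  \<open>S p\<^sub>m\<^sub>n = q\<^sub>m\<^sub>n S\<close>. Such relations hold for \<open>T\<close> too, which gives \<open>T\<^sup>\<infinity> x = T\<^sup>\<infinity> P x = Q T\<^sup>\<infinity> x \<in> K\<close>.
\<close>

lemma amplify_Ref:
  fixes \<U> :: "('a::chilbert_space \<Rightarrow> 'b::chilbert_space) set"
  assumes norm: "normalizing \<U>" and T: "T \<in> Ref \<U>"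
  shows "amplify T x \<in> closure ((\<lambda>S. amplify S x) ` \<U>)"
proof -
  have U: "\<U> \<subseteq> bounded_ops" and U0: "(\<lambda>_. 0) \<in> \<U>"
    and Uadd: "\<And>S T. S \<in> \<U> \<Longrightarrow> T \<in> \<U> \<Longrightarrow> (\<lambda>x. S x + T x) \<in> \<U>"
    and Uscale: "\<And>c T. T \<in> \<U> \<Longrightarrow> (\<lambda>x. c *\<^sub>C T x) \<in> \<U>"
    and Utriple: "\<And>A B C. A \<in> \<U> \<Longrightarrow> B \<in> \<U> \<Longrightarrow> C \<in> \<U> \<Longrightarrow> A \<circ> cadjoint B \<circ> C \<in> \<U>"
    using norm by (auto simp: normalizing_def operator_space_def)
  note T_ops = Ref_bounded_ops[OF T]
  have S_ops: "S \<in> bounded_ops" if "S \<in> \<U>" for S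
    using that U by blast
  have amp_ops: "amplify S \<in> bounded_ops" if "S \<in> \<U>" for S
    using amplify_bounded_ops[OF S_ops[OF that]] .
  define K where "K = closure ((\<lambda>S. amplify S x) ` \<U>)"
  have K: "closed_csubspace K"
    unfolding K_def
  proof (rule closed_csubspace_closure)
    have "0 = amplify (\<lambda>_. 0 :: 'b) x"
      by (rule l2_eqI) (simp add: l2_nth_amplify bounded_ops_zero zero_l2.rep_eq)
    moreover have "amplify S x + amplify S' x = amplify (\<lambda>x. S x + S' x) x"
      if "S \<in> \<U>" "S' \<in> \<U>" for S S'
      by (rule l2_eqI) (use that in \<open>simp add: l2_nth_amplify S_ops bounded_ops_plus plus_l2.rep_eq\<close>)
    moreover have "c *\<^sub>C amplify S x = amplify (\<lambda>x. c *\<^sub>C S x) x" if "S \<in> \<U>" for c S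
      by (rule l2_eqI) (use that in \<open>simp add: l2_nth_amplify S_ops bounded_ops_scale scaleC_l2.rep_eq\<close>)
    ultimately show "complex_vector.subspace ((\<lambda>S. amplify S x) ` \<U>)"
      unfolding complex_vector.subspace_def using U0 Uadd Uscale by auto
  qed
  have in_K: "amplify S x \<in> K" if "S \<in> \<U>" for S
    unfolding K_def using that by (intro subsetD[OF closure_subset] imageI)
  define M where "M = {z. \<forall>S\<in>\<U>. amplify S z \<in> K}"
  have M: "closed_csubspace M"
    using closed_csubspace_residual[of "amplify ` \<U>" K] amp_ops K by (auto simp: M_def)
  have xM: "x \<in> M"
    using in_K by (simp add: M_def)
  have adj_M: "cadjoint (amplify S) y \<in> M" if S: "S \<in> \<U>" and y: "y \<in> K" for S y
  proof -
    note adj_ops = cadjoint_bounded_ops[OF amp_ops[OF S]]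
    have "K \<subseteq> {y. cadjoint (amplify S) y \<in> M}"
      unfolding K_def
    proof (rule closure_minimal)
      show "closed {y. cadjoint (amplify S) y \<in> M}"
        using closed_csubspace_vimage[OF adj_ops M] by blast
      have "amplify R (cadjoint (amplify S) (amplify C x)) \<in> K" if "R \<in> \<U>" "C \<in> \<U>" for R C
      proof -
        have "amplify R (cadjoint (amplify S) (amplify C x)) = amplify (R \<circ> cadjoint S \<circ> C) x"
          using that S by (simp add: cadjoint_amplify amplify_comp bounded_ops_comp S_ops
              cadjoint_bounded_ops)
        then show ?thesis
          using in_K[OF Utriple[OF that(1) S that(2)]] by simp
      qed
      then show "(\<lambda>S. amplify S x) ` \<U> \<subseteq> {y. cadjoint (amplify S) y \<in> M}"
        by (auto simp: M_def)
    qed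
    then show ?thesis using y by blast
  qed
  define P where "P = proj_onto M"
  define Q where "Q = proj_onto K"
  have P: "P \<in> projections" "range P = M" and Q: "Q \<in> projections" "range Q = K"
    unfolding P_def Q_def using proj_onto[OF M] proj_onto[OF K] by auto
  note P_ops = projections_bounded_ops[OF P(1)] and Q_ops = projections_bounded_ops[OF Q(1)]
  have SP: "amplify S (P z) = Q (amplify S z)" if S: "S \<in> \<U>" for S z
  proof (rule proj_intertwine[OF P(1) Q(1) amp_ops[OF S]], unfold P(2) Q(2))
    show "amplify S z \<in> K" if "z \<in> M" for z
      using that S by (simp add: M_def)
    show "amplify S z \<in> ortho_compl K" if "z \<in> ortho_compl M" for z
      by (rule maps_ortho_compl[OF amp_ops[OF S] adj_M[OF S] that])
  qed
  define p where "p m n u = l2_nth (P (l2_single n u)) m" for m n u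
  define q where "q m n v = l2_nth (Q (l2_single n v)) m" for m n v
  have entry_ops: "(\<lambda>u. l2_nth (R (l2_single n u)) m) \<in> bounded_ops"
    if "R \<in> bounded_ops" for R :: "'c::chilbert_space l2 \<Rightarrow> 'c l2" and m n
    using bounded_ops_comp[OF bounded_ops_l2_nth[of m] bounded_ops_comp[OF that bounded_ops_l2_single[of n]]]
    by (simp add: comp_def)
  have entry_adj: "cinner (l2_nth (R (l2_single n u)) m) v = cinner u (l2_nth (R (l2_single m v)) n)"
    if "R \<in> projections" for R :: "'c::chilbert_space l2 \<Rightarrow> 'c l2" and m n u v
    unfolding cinner_l2_single[symmetric] cinner_l2_single_left[symmetric]
    by (rule projections_cinner[OF that])
  have p_ops: "p m n \<in> bounded_ops" and q_ops: "q m n \<in> bounded_ops" for m n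
    using entry_ops[OF P_ops, of n m] entry_ops[OF Q_ops, of n m]
    unfolding p_def[abs_def] q_def[abs_def] .
  have p_adj: "cinner (p m n x) y = cinner x (p n m y)" for m n x y
    unfolding p_def by (rule entry_adj[OF P(1)])
  have q_adj: "cinner (q m n x) y = cinner x (q n m y)" for m n x y
    unfolding q_def by (rule entry_adj[OF Q(1)])
  have S_entry: "S (p m n u) = q m n (S u)" if S: "S \<in> \<U>" for S m n u
    using arg_cong[OF SP[OF S, of "l2_single n u"], of "\<lambda>z. l2_nth z m"] S
    by (simp add: p_def q_def l2_nth_amplify amplify_l2_single S_ops)
  have T_entry: "T (p m n u) = q m n (T u)" for m n u
    by (rule Ref_intertwines[OF U T p_ops p_ops q_ops q_ops p_adj q_adj S_entry S_entry])
  have "amplify T (P z) = Q (amplify T z)" for z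
  proof (rule bounded_ops_eq_on_l2_single[of "\<lambda>z. amplify T (P z)" "\<lambda>z. Q (amplify T z)"])
    note amp_T = amplify_bounded_ops[OF T_ops]
    show "(\<lambda>z. amplify T (P z)) \<in> bounded_ops" "(\<lambda>z. Q (amplify T z)) \<in> bounded_ops"
      using bounded_ops_comp[OF amp_T P_ops] bounded_ops_comp[OF Q_ops amp_T]
      by (simp_all add: comp_def)
    show "amplify T (P (l2_single n u)) = Q (amplify T (l2_single n u))" for n u
    proof (rule l2_eqI)
      fix m
      show "l2_nth (amplify T (P (l2_single n u))) m = l2_nth (Q (amplify T (l2_single n u))) m"
        using T_entry[of m n u] by (simp add: p_def q_def l2_nth_amplify[OF T_ops] amplify_l2_single[OF T_ops])
    qed
  qed
  moreover have "P x = x"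
    using xM P in_range_projection_iff by blast
  ultimately have "amplify T x = Q (amplify T x)"
    by metis
  then have "amplify T x \<in> K"
    using Q(2) by (metis rangeI)
  then show ?thesis
    by (simp add: K_def)
qed


section \<open>The weak operator topology and the ultraweak topology\<close>

lift_definition l2_interleave :: "'a::complex_inner l2 \<Rightarrow> 'a l2 \<Rightarrow> 'a l2"
  is "\<lambda>x y n. if even n then x (n div 2) else y ((n - 1) div 2)"
proof -
  fix x y :: "nat \<Rightarrow> 'a"
  assume "summable (\<lambda>n. (norm (x n))\<^sup>2)" "summable (\<lambda>n. (norm (y n))\<^sup>2)"
  from sums_if[OF summable_sums[OF this(2)] summable_sums[OF this(1)]]
  show "summable (\<lambda>n. (norm (if even n then x (n div 2) else y ((n - 1) div 2)))\<^sup>2)"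
    by (simp add: sums_iff if_distrib[of "\<lambda>z. (norm z)\<^sup>2"])
qed

lemma norm_sq_l2_interleave: "(norm (l2_interleave x y))\<^sup>2 = (norm x)\<^sup>2 + (norm y)\<^sup>2"
  using sums_if[OF summable_sums[OF summable_l2[of y]] summable_sums[OF summable_l2[of x]]]
  unfolding norm_sq_l2
  by (simp add: sums_iff l2_interleave.rep_eq if_distrib[of "\<lambda>z. (norm z)\<^sup>2"] add.commute)

lemma amplify_diff_l2_interleave:
  assumes "S \<in> bounded_ops" "T \<in> bounded_ops"
  shows "amplify S (l2_interleave x y) - amplify T (l2_interleave x y) =
    l2_interleave (amplify S x - amplify T x) (amplify S y - amplify T y)"
  by (rule l2_eqI) (simp add: l2_nth_amplify assms minus_l2.rep_eq l2_interleave.rep_eq)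

text \<open>
  Every ultraweak neighbourhood is determined by one square-summable sequence: the sequences for
  finitely many functionals can be interleaved, and \<open>\<Sum>n. \<langle>S x\<^sub>n, y\<^sub>n\<rangle>\<close> depends
  continuously on \<open>S\<^sup>\<infinity> x\<close> by the Cauchy-Schwarz inequality.
\<close>

lemma ultraweak_neighbourhood:
  fixes W :: "('a::complex_inner \<Rightarrow> 'b::complex_inner) set"
  assumes W: "openin ultraweak_topology W" and T: "T \<in> W" "T \<in> bounded_ops"
  shows "\<exists>x. \<exists>e>0. \<forall>S\<in>bounded_ops. norm (amplify S x - amplify T x) < e \<longrightarrow> S \<in> W"
  using W[unfolded ultraweak_topology_def openin_topology_generated_by_iff] T(1)
proof (induction W rule: generate_topology_on.induct)
  case Empty
  then show ?case by simp
next
  case (Int W W')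
  obtain x e where x: "0 < e" "\<forall>S\<in>bounded_ops. norm (amplify S x - amplify T x) < e \<longrightarrow> S \<in> W"
    using Int by blast
  obtain y d where y: "0 < d" "\<forall>S\<in>bounded_ops. norm (amplify S y - amplify T y) < d \<longrightarrow> S \<in> W'"
    using Int by blast
  have "S \<in> W \<inter> W'"
    if S: "S \<in> bounded_ops"
      and lt: "norm (amplify S (l2_interleave x y) - amplify T (l2_interleave x y)) < min e d" for S
  proof -
    have "(norm (amplify S x - amplify T x))\<^sup>2 + (norm (amplify S y - amplify T y))\<^sup>2 < (min e d)\<^sup>2"
      using lt power_strict_mono[OF lt, of 2]
      by (simp add: amplify_diff_l2_interleave S T norm_sq_l2_interleave)
    then have lt2: "(norm (amplify S x - amplify T x))\<^sup>2 < (min e d)\<^sup>2"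
      "(norm (amplify S y - amplify T y))\<^sup>2 < (min e d)\<^sup>2"
      using zero_le_power2[of "norm (amplify S x - amplify T x)"]
        zero_le_power2[of "norm (amplify S y - amplify T y)"] by linarith+
    have "norm (amplify S x - amplify T x) < min e d" "norm (amplify S y - amplify T y) < min e d"
      by (rule power2_less_imp_less, rule lt2, use x(1) y(1) in simp)+
    then show ?thesis
      using x y S by auto
  qed
  then show ?case
    using x(1) y(1) by (intro exI[of _ "l2_interleave x y"] exI[of _ "min e d"]) auto
next
  case (UN \<W>)
  then obtain W where W: "W \<in> \<W>" "T \<in> W" by blast
  from UN.IH[OF W] obtain x e where
    "0 < e" "\<forall>S\<in>bounded_ops. norm (amplify S x - amplify T x) < e \<longrightarrow> S \<in> W" by blast
  then show ?case
    using W by blast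
next
  case (Basis W)
  then obtain x y V where W: "W = {T \<in> bounded_ops. (\<Sum>n. cinner (T (x n)) (y n)) \<in> V}"
    and sum: "summable (\<lambda>n. (norm (x n))\<^sup>2)" "summable (\<lambda>n. (norm (y n))\<^sup>2)" and V: "open V"
    by blast
  have nth: "l2_nth (Abs_l2 x) = x" "l2_nth (Abs_l2 y) = y"
    using sum by (simp_all add: Abs_l2_inverse)
  have eq: "(\<Sum>n. cinner (S (x n)) (y n)) = cinner (amplify S (Abs_l2 x)) (Abs_l2 y)"
    if "S \<in> bounded_ops" for S :: "'a \<Rightarrow> 'b"
    using that by (simp add: cinner_l2_def l2_nth_amplify nth)
  have "cinner (amplify T (Abs_l2 x)) (Abs_l2 y) \<in> V"
    using Basis W eq[OF T(2)] by simp
  then obtain d where d: "0 < d" "\<And>z. dist z (cinner (amplify T (Abs_l2 x)) (Abs_l2 y)) < d \<Longrightarrow> z \<in> V"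
    using V unfolding open_dist by blast
  define e where "e = d / (norm (Abs_l2 y) + 1)"
  have pos: "0 < norm (Abs_l2 y) + 1"
    using norm_ge_zero[of "Abs_l2 y"] by linarith
  have "S \<in> W" if S: "S \<in> bounded_ops" and lt: "norm (amplify S (Abs_l2 x) - amplify T (Abs_l2 x)) < e" for S
  proof -
    let ?n = "norm (amplify S (Abs_l2 x) - amplify T (Abs_l2 x))"
    have "dist (cinner (amplify S (Abs_l2 x)) (Abs_l2 y)) (cinner (amplify T (Abs_l2 x)) (Abs_l2 y))
        \<le> ?n * norm (Abs_l2 y)"
      unfolding dist_norm cinner_diff_left[symmetric] by (rule cauchy_schwarz)
    also have "\<dots> \<le> ?n * (norm (Abs_l2 y) + 1)"
      by (intro mult_left_mono) auto
    also have "\<dots> < d"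
      using lt pos by (simp add: e_def pos_less_divide_eq)
    finally show ?thesis
      using d S eq[OF S] by (simp add: W)
  qed
  moreover have "0 < e"
    using d pos by (simp add: e_def)
  ultimately show ?case by blast
qed

lemma weak_operator_basis_ultraweak_open:
  fixes x :: "'a::complex_inner" and y :: "'b::complex_inner"
  assumes "open V"
  shows "openin ultraweak_topology {T \<in> bounded_ops. cinner (T x) y \<in> V}"
  unfolding ultraweak_topology_def openin_topology_generated_by_iff
proof (rule generate_topology_on.Basis, intro CollectI exI conjI)
  let ?x = "\<lambda>n. if n = 0 then x else 0" and ?y = "\<lambda>n::nat. if n = 0 then y else 0"
  have "(\<lambda>n::nat. cinner (T (?x n)) (?y n)) = (\<lambda>n. if n = 0 then cinner (T x) y else 0)" for T
    by auto
  then have "(\<Sum>n::nat. cinner (T (?x n)) (?y n)) = cinner (T x) y" for T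
    using sums_single[of 0 "\<lambda>_. cinner (T x) y"] by (simp add: sums_iff)
  then show "{T \<in> bounded_ops. cinner (T x) y \<in> V} =
      {T \<in> bounded_ops. (\<Sum>n::nat. cinner (T (?x n)) (?y n)) \<in> V}"
    by simp
  show "summable (\<lambda>n::nat. (norm (?x n))\<^sup>2)" "summable (\<lambda>n::nat. (norm (?y n))\<^sup>2)"
    by (rule summable_finite[of "{0}"]; simp)+
qed (rule assms)

lemma weak_operator_basis_open:
  assumes "open V"
  shows "openin weak_operator_topology {T \<in> bounded_ops. cinner (T x) y \<in> V}"
  unfolding weak_operator_topology_def openin_topology_generated_by_iff
  by (rule generate_topology_on.Basis) (use assms in blast)

lemma weak_operator_open_imp_ultraweak_open:
  assumes "openin weak_operator_topology W"
  shows "openin ultraweak_topology W"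
  using assms[unfolded weak_operator_topology_def openin_topology_generated_by_iff]
proof (induction W rule: generate_topology_on.induct)
  case (Basis W)
  then show ?case
    using weak_operator_basis_ultraweak_open by blast
qed auto

text \<open>A closed subspace is cut out by the functionals \<open>\<langle>\<cdot>, y\<rangle>\<close> with \<open>y\<close> orthogonal to it.\<close>

lemma closure_of_subset_Ref:
  fixes \<U> :: "('a::chilbert_space \<Rightarrow> 'b::chilbert_space) set"
  assumes U: "operator_space \<U>" and top: "topspace X \<subseteq> bounded_ops"
    and basis: "\<And>x y V. open V \<Longrightarrow> openin X {T \<in> bounded_ops. cinner (T x) y \<in> V}"
  shows "X closure_of \<U> \<subseteq> Ref \<U>"
proof
  fix T assume T: "T \<in> X closure_of \<U>"
  then have T_ops: "T \<in> bounded_ops"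
    using top by (auto simp: in_closure_of)
  have "T x \<in> closure {S x | S. S \<in> \<U>}" for x
  proof -
    let ?K = "closure {S x | S. S \<in> \<U>}"
    have "complex_vector.subspace {S x | S. S \<in> \<U>}"
      unfolding complex_vector.subspace_def
    proof (intro conjI ballI allI)
      show "0 \<in> {S x | S. S \<in> \<U>}"
        using U by (auto simp: operator_space_def intro!: exI[of _ "\<lambda>_. 0"])
      fix a b assume "a \<in> {S x | S. S \<in> \<U>}" "b \<in> {S x | S. S \<in> \<U>}"
      then obtain S S' where "a = S x" "b = S' x" "S \<in> \<U>" "S' \<in> \<U>" by blast
      then show "a + b \<in> {S x | S. S \<in> \<U>}"
        using U by (auto simp: operator_space_def intro!: exI[of _ "\<lambda>x. S x + S' x"])
    next
      fix a c assume "a \<in> {S x | S. S \<in> \<U>}"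
      then obtain S where "a = S x" "S \<in> \<U>" by blast
      then show "c *\<^sub>C a \<in> {S x | S. S \<in> \<U>}"
        using U by (auto simp: operator_space_def intro!: exI[of _ "\<lambda>x. c *\<^sub>C S x"])
    qed
    then have K: "closed_csubspace ?K"
      by (rule closed_csubspace_closure)
    have "cinner (T x) y = 0" if y: "y \<in> ortho_compl ?K" for y
    proof (rule ccontr)
      assume "cinner (T x) y \<noteq> 0"
      then have "T \<in> {S \<in> bounded_ops. cinner (S x) y \<in> - {0}}"
        using T_ops by simp
      moreover have "openin X {S \<in> bounded_ops. cinner (S x) y \<in> - {0}}"
        by (rule basis) (rule open_Compl, simp)
      ultimately have "\<exists>S. S \<in> \<U> \<and> S \<in> {S \<in> bounded_ops. cinner (S x) y \<in> - {0}}"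
        by (intro T[unfolded in_closure_of, THEN conjunct2, rule_format] conjI)
      then obtain S where S: "S \<in> \<U>" "cinner (S x) y \<noteq> 0"
        by auto
      have "S x \<in> ?K"
        using S(1) by (intro subsetD[OF closure_subset]) auto
      then have "cinner y (S x) = 0"
        using y by (simp add: ortho_compl_def)
      then show False
        using S cinner_commute[of "S x" y] by simp
    qed
    then have "T x \<in> ortho_compl (ortho_compl ?K)"
      by (simp add: ortho_compl_def[of "ortho_compl ?K"])
    then show ?thesis
      by (simp add: ortho_compl_ortho_compl[OF K])
  qed
  then show "T \<in> Ref \<U>"
    using T_ops by (simp add: Ref_def)
qed

lemma topspace_weak_operator: "topspace weak_operator_topology = bounded_ops"
proof
  show "topspace weak_operator_topology \<subseteq> bounded_ops"
    unfolding weak_operator_topology_def topology_generated_by_topspace by blast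
  show "(bounded_ops :: ('a \<Rightarrow> 'b) set) \<subseteq> topspace weak_operator_topology"
    using openin_subset[OF weak_operator_basis_open[of UNIV "0 :: 'a" "0 :: 'b"]] by simp
qed

lemma topspace_ultraweak: "topspace ultraweak_topology = bounded_ops"
proof
  show "topspace ultraweak_topology \<subseteq> bounded_ops"
    unfolding ultraweak_topology_def topology_generated_by_topspace by blast
  show "(bounded_ops :: ('a \<Rightarrow> 'b) set) \<subseteq> topspace ultraweak_topology"
    using openin_subset[OF weak_operator_basis_ultraweak_open[of UNIV "0 :: 'a" "0 :: 'b"]] by simp
qed

lemma Ref_subset_ultraweak_closure:
  fixes \<U> :: "('a::chilbert_space \<Rightarrow> 'b::chilbert_space) set"
  assumes "normalizing \<U>"
  shows "Ref \<U> \<subseteq> ultraweak_topology closure_of \<U>"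
proof
  fix T assume T: "T \<in> Ref \<U>"
  have U: "\<U> \<subseteq> bounded_ops"
    using assms by (simp add: normalizing_def operator_space_def)
  show "T \<in> ultraweak_topology closure_of \<U>"
    unfolding in_closure_of topspace_ultraweak
  proof (intro conjI allI impI)
    show "T \<in> bounded_ops" by (rule Ref_bounded_ops[OF T])
    fix W assume W: "T \<in> W \<and> openin ultraweak_topology W"
    then obtain x e where e: "0 < e"
      "\<forall>S\<in>bounded_ops. norm (amplify S x - amplify T x) < e \<longrightarrow> S \<in> W"
      using ultraweak_neighbourhood[of W T] Ref_bounded_ops[OF T] by blast
    obtain S where "S \<in> \<U>" "dist (amplify S x) (amplify T x) < e"
      using amplify_Ref[OF assms T, of x] e(1) unfolding closure_approachable by blast
    then show "\<exists>S. S \<in> \<U> \<and> S \<in> W"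
      using e(2) U by (auto simp: dist_norm)
  qed
qed

lemma Ref_eq_closures:
  fixes \<U> :: "('a::chilbert_space \<Rightarrow> 'b::chilbert_space) set"
  assumes U: "normalizing \<U>"
  shows "Ref \<U> = weak_operator_topology closure_of \<U>"
    and "Ref \<U> = ultraweak_topology closure_of \<U>"
proof -
  have space: "operator_space \<U>"
    using U by (simp add: normalizing_def)
  have "ultraweak_topology closure_of \<U> \<subseteq> weak_operator_topology closure_of \<U>"
    using weak_operator_open_imp_ultraweak_open
    unfolding closure_of_def topspace_ultraweak topspace_weak_operator by blast
  moreover have "weak_operator_topology closure_of \<U> \<subseteq> Ref \<U>"
    by (rule closure_of_subset_Ref[OF space]) (simp_all add: topspace_weak_operator weak_operator_basis_open)
  ultimately show "Ref \<U> = weak_operator_topology closure_of \<U>"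
    "Ref \<U> = ultraweak_topology closure_of \<U>"
    using Ref_subset_ultraweak_closure[OF U] by blast+
qed

theorem theorem2p4:
  shows "(\<forall>\<phi> :: ('a::chilbert_space \<Rightarrow> 'a) \<Rightarrow> ('b::chilbert_space \<Rightarrow> 'b). \<phi> \<in> sup_maps \<longrightarrow>
            intertwiners \<phi> = Op \<phi> \<inter> Op (map_perp \<phi>) \<and> normalizing (intertwiners \<phi>)) \<and>
         (\<forall>\<U> :: ('a \<Rightarrow> 'b) set. normalizing \<U> \<longrightarrow>
            ortho_map (Map \<U>) \<and>
            Ref \<U> = weak_operator_topology closure_of \<U> \<and>
            Ref \<U> = ultraweak_topology closure_of \<U>) \<and>
         (\<forall>\<psi> :: ('a \<Rightarrow> 'a) \<Rightarrow> ('b \<Rightarrow> 'b). ortho_map \<psi> \<longrightarrow>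
            Op \<psi> = intertwiners \<psi>)"
proof (intro conjI allI impI)
  fix \<phi> :: "('a \<Rightarrow> 'a) \<Rightarrow> ('b \<Rightarrow> 'b)"
  assume "\<phi> \<in> sup_maps"
  then show "intertwiners \<phi> = Op \<phi> \<inter> Op (map_perp \<phi>)" "normalizing (intertwiners \<phi>)"
    by (rule intertwiners_eq_Op_Int, rule normalizing_intertwiners)
next
  fix \<U> :: "('a \<Rightarrow> 'b) set"
  assume "normalizing \<U>"
  then show "ortho_map (Map \<U>)" "Ref \<U> = weak_operator_topology closure_of \<U>"
    "Ref \<U> = ultraweak_topology closure_of \<U>"
    by (rule ortho_map_Map, rule Ref_eq_closures(1), rule Ref_eq_closures(2))
next
  fix \<psi> :: "('a \<Rightarrow> 'a) \<Rightarrow> ('b \<Rightarrow> 'b)"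
  assume "ortho_map \<psi>"
  then show "Op \<psi> = intertwiners \<psi>" by (rule Op_ortho_map)
qed

end
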